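(* For all positive integers $n,d$ we have $g(n,d)\leq n+3d-3$. Equivalently, every $n$-vertex graph $G$ such that $\deg_G(u)+\deg_G(v)\geq n+3d-3$ for every pair of distinct non-adjacent vertices $u,v$ is $d$-rigid.
   Context: All graphs are finite and simple. A graph $G$ is $d$-rigid if some (equivalently every) generic $d$-dimensional bar-and-joint framework $(G,p)$ (with $p:V(G)\to\mathbb{R}^d$ having coordinates algebraically independent over $\mathbb{Q}$) is rigid, i.e. admits no continuous edge-length-preserving motion that changes some pairwise distance between vertices. For a graph $G=(V,E)$, $\eta(G)=\min_{uv\notin E,\,u\neq v}(\deg_G(u)+\deg_G(v))$ (taken as $+\infty$ if $G$ is complete). For $n,d\in\mathbb{N}$, $g(n,d)$ is the smallest integer such that every $n$-vertex graph $G$ with $\eta(G)\geq g(n,d)$ is $d$-rigid. *)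

theory Defs
  imports Complex_Main
begin

definition simple_graph :: "'a set \<Rightarrow> ('a \<Rightarrow> 'a \<Rightarrow> bool) \<Rightarrow> bool" where
  "simple_graph V E \<longleftrightarrow> finite V \<and> (\<forall>u v. E u v \<longrightarrow> E v u) \<and> (\<forall>u. \<not> E u u)
     \<and> (\<forall>u v. E u v \<longrightarrow> u \<in> V \<and> v \<in> V)"

definition degree :: "'a set \<Rightarrow> ('a \<Rightarrow> 'a \<Rightarrow> bool) \<Rightarrow> 'a \<Rightarrow> nat" where
  "degree V E u = card {v \<in> V. E u v}"

text \<open>Placements in R^d are maps p :: 'a => nat => real; only coordinates i < d matter.
Squared Euclidean distance between the images of u and v.\<close>
definition sqdist :: "nat \<Rightarrow> ('a \<Rightarrow> nat \<Rightarrow> real) \<Rightarrow> 'a \<Rightarrow> 'a \<Rightarrow> real" where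
  "sqdist d p u v = (\<Sum>i<d. (p u i - p v i)^2)"

definition alg_indep_Q :: "'i set \<Rightarrow> ('i \<Rightarrow> real) \<Rightarrow> bool" where
  "alg_indep_Q I x \<longleftrightarrow>
     (\<forall>(M :: ('i \<Rightarrow> nat) set) (c :: ('i \<Rightarrow> nat) \<Rightarrow> rat).
        finite M \<longrightarrow> (\<forall>\<alpha>\<in>M. \<forall>i. i \<notin> I \<longrightarrow> \<alpha> i = 0) \<longrightarrow>
        (\<Sum>\<alpha>\<in>M. of_rat (c \<alpha>) * (\<Prod>i\<in>I. x i ^ \<alpha> i)) = 0 \<longrightarrow>
        (\<forall>\<alpha>\<in>M. c \<alpha> = 0))"

definition generic :: "'a set \<Rightarrow> nat \<Rightarrow> ('a \<Rightarrow> nat \<Rightarrow> real) \<Rightarrow> bool" where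
  "generic V d p \<longleftrightarrow> alg_indep_Q (V \<times> {..<d}) (\<lambda>(v, i). p v i)"

definition rigid_framework ::
    "'a set \<Rightarrow> ('a \<Rightarrow> 'a \<Rightarrow> bool) \<Rightarrow> nat \<Rightarrow> ('a \<Rightarrow> nat \<Rightarrow> real) \<Rightarrow> bool" where
  "rigid_framework V E d p \<longleftrightarrow>
     \<not> (\<exists>q :: real \<Rightarrow> 'a \<Rightarrow> nat \<Rightarrow> real.
          (\<forall>v\<in>V. \<forall>i<d. continuous_on {0..1} (\<lambda>t. q t v i)) \<and>
          (\<forall>v\<in>V. \<forall>i<d. q 0 v i = p v i) \<and>
          (\<forall>t\<in>{0..1}. \<forall>u\<in>V. \<forall>v\<in>V. E u v \<longrightarrow> sqdist d (q t) u v = sqdist d p u v) \<and>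
          (\<exists>t\<in>{0..1}. \<exists>u\<in>V. \<exists>v\<in>V. sqdist d (q t) u v \<noteq> sqdist d p u v))"

definition d_rigid :: "'a set \<Rightarrow> ('a \<Rightarrow> 'a \<Rightarrow> bool) \<Rightarrow> nat \<Rightarrow> bool" where
  "d_rigid V E d \<longleftrightarrow> (\<forall>p. generic V d p \<longrightarrow> rigid_framework V E d p)"

end

theory Submission
  imports "Jordan_Normal_Form.Determinant" "HOL-Computational_Algebra.Field_as_Ring"
    "HOL-Computational_Algebra.Polynomial_Factorial" Defs
begin

text \<open>Place the vertices at distinct points \<open>\<tau> v\<close> of the moment curve \<open>(t, t\<^sup>2, \<dots>, t\<^sup>d)\<close>. An
  infinitesimal motion becomes a family of polynomials \<open>f\<^sub>v\<close> of degree at most \<open>d\<close> with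
  \<open>f\<^sub>v (\<tau> v) = 0\<close>, and the strain of the pair \<open>u, v\<close> is \<open>f\<^sub>u (\<tau> v) + f\<^sub>v (\<tau> u)\<close>. So for a motion that
  respects the edges, \<open>f\<^sub>v (\<tau> u)\<close> and \<open>- f\<^sub>u (\<tau> v)\<close> are two versions of one \<open>n \<times> n\<close> array, with
  rows, respectively columns, of degree at most \<open>d\<close>, and they differ only at non-edges. The Ore
  condition and Cauchy-Schwarz leave at most \<open>n (n - 3 d + 1) / 2\<close> such errors. Decoding in the style
  of Berlekamp-Welch, with bivariate error locator polynomials, yields one polynomial \<open>Q\<close> of
  bidegree at most \<open>(d, d)\<close> that agrees with most of the \<open>f\<^sub>v\<close>; the Ore condition, used once more,
  rules out any error at all. Hence the framework on the moment curve is infinitesimally rigid.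

  Gram determinants of rows of the rigidity matrix are polynomials in the placement, so an
  independent set of edges of maximal rank transfers to every generic placement. They are moreover
  functions of the pairwise distances. Along a flex \<open>q\<close>, the difference \<open>q t - q s\<close> is an
  infinitesimal motion at the midpoint \<open>(q s + q t) / 2\<close>, so if \<open>q s\<close> is congruent to the generic
  placement, then all distances are constant near \<open>s\<close>; connectedness of the interval concludes.\<close>

section \<open>Linear systems and roots of polynomials\<close>

abbreviation deg :: "'a::zero poly \<Rightarrow> nat" where
  "deg \<equiv> Polynomial.degree"

text \<open>Gaussian elimination by induction on the equations: one equation is solved for an
  unknown, which is then eliminated from the others. The polynomials and motions found by counting
  come from here.\<close>

lemma underdetermined_system:
  fixes A :: "'j \<Rightarrow> 'i \<Rightarrow> 'k::field"
  assumes "finite J" "finite I" "card J < card I"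
  shows "\<exists>c. (\<exists>i\<in>I. c i \<noteq> 0) \<and> (\<forall>j\<in>J. (\<Sum>i\<in>I. A j i * c i) = 0)"
  using assms
proof (induction J arbitrary: A I rule: finite_induct)
  case empty
  then have "I \<noteq> {}" by auto
  then show ?case by (intro exI[of _ "\<lambda>_. 1"]) auto
next
  case (insert j J)
  show ?case
  proof (cases "\<forall>i\<in>I. A j i = 0")
    case True
    from insert have "card J < card I" by auto
    from insert.IH[OF insert.prems(1) this, of A]
    obtain c where "\<exists>i\<in>I. c i \<noteq> 0" "\<forall>j\<in>J. (\<Sum>i\<in>I. A j i * c i) = 0" by blast
    with True show ?thesis by (intro exI[of _ c]) auto
  next
    case False
    then obtain k where k: "k \<in> I" "A j k \<noteq> 0" by blast
    define I' where "I' = I - {k}"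
    have I': "finite I'" "k \<notin> I'" "I = insert k I'" using k insert.prems by (auto simp: I'_def)
    have "card J < card I'" using insert I' by auto
    from insert.IH[OF I'(1) this, of "\<lambda>l i. A l i - A l k * A j i / A j k"]
    obtain c where c: "\<exists>i\<in>I'. c i \<noteq> 0"
      "\<forall>l\<in>J. (\<Sum>i\<in>I'. (A l i - A l k * A j i / A j k) * c i) = 0" by blast
    define s where "s = (\<Sum>i\<in>I'. A j i * c i)"
    define c' where "c' = c(k := - s / A j k)"
    have sum: "(\<Sum>i\<in>I. A l i * c' i) = (\<Sum>i\<in>I'. A l i * c i) - A l k * s / A j k" for l
    proof -
      have "(\<Sum>i\<in>I'. A l i * c' i) = (\<Sum>i\<in>I'. A l i * c i)"
        using I' by (intro sum.cong) (auto simp: c'_def)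
      then show ?thesis using I' by (simp add: c'_def)
    qed
    have "(\<Sum>i\<in>I. A l i * c' i) = 0" if "l \<in> J" for l
    proof -
      have "(\<Sum>i\<in>I'. (A l i - A l k * A j i / A j k) * c i)
            = (\<Sum>i\<in>I'. A l i * c i) - (\<Sum>i\<in>I'. A l k / A j k * (A j i * c i))"
        by (simp add: sum_subtractf algebra_simps)
      also have "(\<Sum>i\<in>I'. A l k / A j k * (A j i * c i)) = A l k * s / A j k"
        by (simp add: s_def sum_distrib_left sum_divide_distrib)
      finally show ?thesis using c that sum by auto
    qed
    moreover have "(\<Sum>i\<in>I. A j i * c' i) = 0"
      using sum[of j] k by (simp add: s_def)
    moreover have "\<exists>i\<in>I. c' i \<noteq> 0" using c(1) I' by (auto simp: c'_def)
    ultimately show ?thesis by (intro exI[of _ c']) auto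
  qed
qed

lemma poly_altdef_le:
  fixes p :: "'a::comm_semiring_1 poly"
  assumes "deg p \<le> k"
  shows "poly p x = (\<Sum>i\<le>k. coeff p i * x ^ i)"
  unfolding poly_altdef using assms
  by (intro sum.mono_neutral_left) (auto simp: coeff_eq_0)

lemma poly_eq_0_many:
  fixes p :: "real poly"
  assumes "finite T" "deg p < card T" "\<And>t. t \<in> T \<Longrightarrow> poly p t = 0"
  shows "p = 0"
proof (rule ccontr)
  assume "p \<noteq> 0"
  then have "card {z. poly p z = 0} \<le> deg p" "finite {z. poly p z = 0}"
    by (auto intro: card_poly_roots_bound poly_roots_finite)
  with assms(3) have "card T \<le> deg p" by (metis (mono_tags, lifting) card_mono mem_Collect_eq order_trans subsetI)
  then show False using assms(2) by simp
qed

section \<open>Bivariate polynomials\<close>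

text \<open>An element of \<open>real poly poly\<close> is read as a polynomial in \<open>Y\<close> over \<open>\<real>[X]\<close>: \<open>colp p y\<close>
  substitutes \<open>Y = y\<close> and \<open>rowp p x\<close> substitutes \<open>X = x\<close>.\<close>

definition colp :: "real poly poly \<Rightarrow> real \<Rightarrow> real poly" where
  "colp p y = poly p [:y:]"

definition rowp :: "real poly poly \<Rightarrow> real \<Rightarrow> real poly" where
  "rowp p x = map_poly (\<lambda>c. poly c x) p"

definition ev :: "real poly poly \<Rightarrow> real \<Rightarrow> real \<Rightarrow> real" where
  "ev p x y = poly (colp p y) x"

text \<open>The exchange of \<open>X\<close> and \<open>Y\<close>. It is a ring automorphism, so
  facts about columns have mirror images about rows.\<close>

definition swap :: "real poly poly \<Rightarrow> real poly poly" where
  "swap p = (\<Sum>j\<le>deg p. \<Sum>i\<le>deg (coeff p j). monom (monom (coeff (coeff p j) i) j) i)"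

lemma coeff_rowp: "coeff (rowp p x) j = poly (coeff p j) x"
  by (simp add: rowp_def coeff_map_poly)

lemma poly_rowp: "poly (rowp p x) y = ev p x y"
proof -
  have "deg (rowp p x) \<le> deg p"
    by (simp add: rowp_def map_poly_degree_leq)
  then have "poly (rowp p x) y = (\<Sum>j\<le>deg p. coeff (rowp p x) j * y ^ j)"
    by (rule poly_altdef_le)
  also have "\<dots> = (\<Sum>j\<le>deg p. poly (coeff p j) x * y ^ j)" by (simp add: coeff_rowp)
  also have "\<dots> = poly (\<Sum>j\<le>deg p. coeff p j * [:y:] ^ j) x"
    by (simp add: poly_sum poly_power)
  finally show ?thesis by (simp add: ev_def colp_def poly_altdef)
qed

lemma poly_colp: "poly (colp p y) x = ev p x y"
  by (simp add: ev_def)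

lemma ev_simps [simp]:
  "ev 0 x y = 0" "ev (p + q) x y = ev p x y + ev q x y" "ev (p - q) x y = ev p x y - ev q x y"
  "ev (p * q) x y = ev p x y * ev q x y" "ev (monom c j) x y = poly c x * y ^ j"
  "ev (sum f A) x y = (\<Sum>a\<in>A. ev (f a) x y)"
  by (auto simp: ev_def colp_def poly_monom poly_sum poly_power)

lemma ev_1 [simp]: "ev 1 x y = 1"
  by (simp add: ev_def colp_def)

lemma ev_const [simp]: "ev [:p:] x y = poly p x"
  by (simp add: ev_def colp_def)

lemma ev_smult [simp]: "ev (smult c p) x y = poly c x * ev p x y"
  by (simp add: ev_def colp_def)

lemma colp_mult: "colp (p * q) y = colp p y * colp q y"
  and colp_add: "colp (p + q) y = colp p y + colp q y"
  and colp_diff: "colp (p - q) y = colp p y - colp q y"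
  by (simp_all add: colp_def)

lemma rowp_mult: "rowp (p * q) x = rowp p x * rowp q x"
  by (auto intro!: poly_ext simp: poly_rowp)

lemma degree_rowp_le: "deg (rowp p x) \<le> deg p"
  by (simp add: rowp_def map_poly_degree_leq)

text \<open>The constants \<open>[:t:]\<close> are roots of \<open>p\<close> in the integral domain
  of real polynomials, where the degree still bounds the number of roots.\<close>

lemma colp_eq_0_many:
  assumes "finite T" "deg p < card T" "\<And>t. t \<in> T \<Longrightarrow> colp p t = 0"
  shows "p = 0"
proof (rule ccontr)
  assume "p \<noteq> 0"
  then have "card {z. poly p z = 0} \<le> deg p" "finite {z. poly p z = 0}"
    by (auto intro: card_poly_roots_bound poly_roots_finite)
  moreover have "(\<lambda>t. [:t:]) ` T \<subseteq> {z. poly p z = 0}"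
    using assms(3) by (auto simp: colp_def)
  ultimately have "card ((\<lambda>t. [:t:]) ` T) \<le> deg p"
    by (meson card_mono order_trans)
  moreover have "card ((\<lambda>t::real. [:t:]) ` T) = card T"
    by (intro card_image) (auto simp: inj_on_def)
  ultimately show False using assms(2) by simp
qed

text \<open>Reduces identities of bivariate polynomials, such as the rules for \<open>swap\<close>,
  to pointwise ones.\<close>

lemma ev_eqI: assumes "\<And>x y. ev p x y = ev q x y" shows "p = q"
proof -
  have "colp (p - q) y = 0" for y
    using assms by (intro poly_ext) (simp add: poly_colp)
  moreover obtain T :: "real set" where "finite T" "card T = Suc (deg (p - q))"
    using infinite_arbitrarily_large[OF infinite_UNIV_char_0[where ?'a = real]] by blast
  ultimately have "p - q = 0"
    by (intro colp_eq_0_many[of T]) auto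
  then show ?thesis by simp
qed

lemma ev_swap [simp]: "ev (swap p) x y = ev p y x"
proof -
  have "ev (swap p) x y = (\<Sum>j\<le>deg p. (\<Sum>i\<le>deg (coeff p j). coeff (coeff p j) i * y ^ i) * x ^ j)"
    by (simp add: swap_def poly_monom sum_distrib_left sum_distrib_right algebra_simps)
  also have "\<dots> = (\<Sum>j\<le>deg p. coeff (rowp p y) j * x ^ j)"
    by (simp add: coeff_rowp poly_altdef)
  also have "\<dots> = poly (rowp p y) x"
    using degree_rowp_le[of p y] by (simp add: poly_altdef_le)
  finally show ?thesis by (simp add: poly_rowp)
qed

lemma swap_swap [simp]: "swap (swap p) = p"
  by (rule ev_eqI) simp

lemma swap_mult: "swap (p * q) = swap p * swap q"
  by (rule ev_eqI) simp

lemma swap_add: "swap (p + q) = swap p + swap q"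
  by (rule ev_eqI) simp

lemma swap_sum: "swap (sum g T) = (\<Sum>t\<in>T. swap (g t))"
  by (rule ev_eqI) simp

lemma swap_1 [simp]: "swap 1 = 1"
  by (rule ev_eqI) simp

lemma swap_0 [simp]: "swap 0 = 0"
  by (rule ev_eqI) simp

lemma swap_eq_0_iff [simp]: "swap p = 0 \<longleftrightarrow> p = 0"
  by (metis swap_0 swap_swap)

lemma rowp_swap [simp]: "rowp (swap p) x = colp p x"
  by (rule poly_ext) (simp add: poly_rowp poly_colp)

lemma colp_swap [simp]: "colp (swap p) x = rowp p x"
  by (metis rowp_swap swap_swap)

text \<open>The degree in \<open>X\<close>; the detour through \<open>swap\<close> lets facts on
  \<open>deg\<close> carry over.\<close>

definition degX :: "real poly poly \<Rightarrow> nat" where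
  "degX p = deg (swap p)"

lemma degX_swap [simp]: "degX (swap p) = deg p"
  by (simp add: degX_def)

lemma degX_mult: "p \<noteq> 0 \<Longrightarrow> q \<noteq> 0 \<Longrightarrow> degX (p * q) = degX p + degX q"
  by (simp add: degX_def swap_mult degree_mult_eq)

lemma degX_0 [simp]: "degX 0 = 0" by (simp add: degX_def)

lemma coeff_colp: "coeff (colp p y) i = poly (coeff (swap p) i) y"
  by (metis coeff_rowp rowp_swap)

lemma degree_colp_le: "deg (colp p y) \<le> degX p"
  using degree_rowp_le[of "swap p" y] by (simp add: degX_def)

lemma rowp_eq_0_many:
  assumes "finite T" "degX p < card T" "\<And>t. t \<in> T \<Longrightarrow> rowp p t = 0"
  shows "p = 0"
  using colp_eq_0_many[of T "swap p"] assms by (simp add: degX_def)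

lemma coeff_swap: "coeff (coeff (swap p) i) j = coeff (coeff p j) i"
proof -
  have "coeff (coeff (swap p) i) j
        = (\<Sum>j'\<le>deg p. \<Sum>i'\<le>deg (coeff p j'). if i' = i \<and> j' = j then coeff (coeff p j') i' else 0)"
    by (simp add: swap_def coeff_sum if_distrib[of "\<lambda>c. coeff c _"] cong: if_cong) 
       (intro sum.cong refl, auto)
  also have "\<dots> = (\<Sum>j'\<le>deg p. if j' = j then coeff (coeff p j') i else 0)"
    by (intro sum.cong refl) (auto simp: sum.delta coeff_eq_0 intro!: sum.neutral)
  also have "\<dots> = coeff (coeff p j) i" by (auto simp: sum.delta coeff_eq_0)
  finally show ?thesis .
qed

lemma degX_le_iff: "degX p \<le> k \<longleftrightarrow> (\<forall>j. deg (coeff p j) \<le> k)"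
proof
  assume "degX p \<le> k"
  then have "coeff (coeff p j) i = 0" if "i > k" for i j
    using that coeff_swap[of p i j] by (simp add: degX_def coeff_eq_0)
  then show "\<forall>j. deg (coeff p j) \<le> k" by (auto intro: degree_le)
next
  assume "\<forall>j. deg (coeff p j) \<le> k"
  then have "coeff (swap p) i = 0" if "i > k" for i
    using that by (intro poly_eqI) (auto simp: coeff_swap intro: coeff_eq_0 le_less_trans)
  then show "degX p \<le> k" by (simp add: degX_def degree_le)
qed

section \<open>Polynomials of bounded bidegree as unknowns of linear systems\<close>

definition mkp :: "nat \<Rightarrow> nat \<Rightarrow> (nat \<times> nat \<Rightarrow> real) \<Rightarrow> real poly poly" where
  "mkp a b c = (\<Sum>j<b. monom (\<Sum>i<a. monom (c (i, j)) i) j)"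

lemma ev_mkp: "ev (mkp a b c) x y = (\<Sum>k\<in>{..<a} \<times> {..<b}. c k * (x ^ fst k * y ^ snd k))"
proof -
  have "ev (mkp a b c) x y = (\<Sum>j<b. \<Sum>i<a. c (i, j) * (x ^ i * y ^ j))"
    by (simp add: mkp_def poly_sum poly_monom sum_distrib_right mult.assoc)
  also have "\<dots> = (\<Sum>i<a. \<Sum>j<b. c (i, j) * (x ^ i * y ^ j))" by (rule sum.swap)
  finally show ?thesis by (simp add: sum.cartesian_product split_def)
qed

lemma coeff_mkp: "coeff (coeff (mkp a b c) j) i = (if i < a \<and> j < b then c (i, j) else 0)"
proof -
  have "coeff (mkp a b c) j = (if j < b then (\<Sum>i<a. monom (c (i, j)) i) else 0)"
    by (simp add: mkp_def coeff_sum sum.delta)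
  then show ?thesis by (simp add: coeff_sum sum.delta)
qed

lemma degree_mkp_less: "b > 0 \<Longrightarrow> deg (mkp a b c) < b"
proof -
  assume b: "b > 0"
  have "deg (mkp a b c) \<le> b - 1"
    by (rule degree_le) (auto intro!: poly_eqI simp: coeff_mkp)
  then show ?thesis using b by simp
qed

lemma degX_mkp_less: "a > 0 \<Longrightarrow> degX (mkp a b c) < a"
proof -
  assume a: "a > 0"
  have "degX (mkp a b c) \<le> a - 1"
    unfolding degX_le_iff using a by (auto intro!: degree_le simp: coeff_mkp)
  then show ?thesis using a by simp
qed

lemma mkp_nonzero: "k \<in> {..<a} \<times> {..<b} \<Longrightarrow> c k \<noteq> 0 \<Longrightarrow> mkp a b c \<noteq> 0"
  using coeff_mkp[of a b c "snd k" "fst k"] by (auto simp: mem_Times_iff)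

text \<open>\<open>swap\<close> is an involutive ring automorphism, so it carries common divisors to
  common divisors and units to units.\<close>

lemma coprime_swap:
  assumes "coprime p q" shows "coprime (swap p) (swap q)"
proof (rule coprimeI)
  fix c assume "c dvd swap p" "c dvd swap q"
  then obtain k l where "swap p = c * k" "swap q = c * l" by (auto elim!: dvdE)
  then have "p = swap c * swap k" "q = swap c * swap l"
    by (metis swap_mult swap_swap)+
  then have "swap c dvd p" "swap c dvd q" by auto
  with assms have "is_unit (swap c)" by (rule coprime_common_divisor)
  then obtain k where "1 = swap c * k" by (auto elim!: dvdE)
  then have "swap 1 = swap (swap c * k)" by simp
  then have "1 = c * swap k" by (simp add: swap_mult)
  then show "is_unit c" by (metis dvd_triv_left)
qed

lemma degX_add_le: "degX p \<le> k \<Longrightarrow> degX q \<le> k \<Longrightarrow> degX (p + q) \<le> k"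
  by (simp add: degX_def swap_add degree_add_le)

lemma degX_sum_le: "finite T \<Longrightarrow> (\<And>t. t \<in> T \<Longrightarrow> degX (g t) \<le> k) \<Longrightarrow> degX (sum g T) \<le> k"
  by (simp add: degX_def swap_sum degree_sum_le)

lemma degX_mult_le: "degX (p * q) \<le> degX p + degX q"
  by (simp add: degX_def swap_mult degree_mult_le)

lemma degX_const: "degX [:p:] = deg p"
proof (rule antisym)
  show "degX [:p:] \<le> deg p" unfolding degX_le_iff by (simp add: coeff_pCons split: nat.splits)
  show "deg p \<le> degX [:p:]" using degX_le_iff[of "[:p:]" "degX [:p:]"] by (auto dest: spec[of _ 0])
qed

text \<open>If the inequality failed, counting dimensions would give \<open>U\<close>, \<open>V\<close>, not both zero, with
  \<open>colp U y + colp V y * f y = 0\<close> for all \<open>y \<in> G\<close>, hence \<open>U * D + V * M = 0\<close>. But then \<open>D\<close>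
  divides \<open>V\<close>, whose degree in \<open>X\<close> is too small.\<close>

lemma syzygy_count:
  fixes f :: "real \<Rightarrow> real poly"
  assumes G: "finite G" and D: "D \<noteq> 0" and cop: "coprime D M"
    and f: "\<And>y. y \<in> G \<Longrightarrow> deg (f y) \<le> d"
    and eq: "\<And>y. y \<in> G \<Longrightarrow> colp M y = colp D y * f y"
    and degM: "deg M \<le> deg D + d"
  shows "degX D * (card G - deg D - d) \<le> (degX D + d) * deg D"
proof (rule ccontr)
  define a b g where "a = degX D" and "b = deg D" and "g = card G"
  assume "\<not> ?thesis"
  then have lt: "(a + d) * b < a * (g - b - d)" by (simp add: a_def b_def g_def)
  then have a0: "a > 0" and g: "g > b + d" by (auto intro!: gr0I) (metis diff_is_0_eq diff_diff_left leI less_nat_zero_code mult_0_right)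
  \<comment> \<open>The polynomials \<open>colp U y + colp V y * f y\<close> below have degree less
    than \<open>a + d\<close>, so they are zero once they vanish on \<open>S\<close>.\<close>
  obtain S :: "real set" where S: "finite S" "card S = a + d"
    using infinite_arbitrarily_large[OF infinite_UNIV_char_0[where ?'a = real]] by blast
  \<comment> \<open>The widths in \<open>Y\<close> keep \<open>U * D\<close> and
    \<open>V * M\<close> below degree \<open>card G\<close>, and \<open>V\<close> has degree less
    than \<open>a\<close> in \<open>X\<close>, too small for a nonzero multiple of
    \<open>D\<close>.\<close>
  define IU where "IU = {..<a + d} \<times> {..<g - b}"
  define IV where "IV = {..<a} \<times> {..<g - b - d}"
  define T :: "real \<times> real \<Rightarrow> (nat \<times> nat) + (nat \<times> nat) \<Rightarrow> real" where
    "T = (\<lambda>(y, s) k. case k of Inl k \<Rightarrow> s ^ fst k * y ^ snd k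
                           | Inr k \<Rightarrow> s ^ fst k * y ^ snd k * poly (f y) s)"
  have fin: "finite IU" "finite IV" by (auto simp: IU_def IV_def)
  have "card (G \<times> S) = g * (a + d)" using S by (simp add: card_cartesian_product g_def)
  \<comment> \<open>The negated claim \<open>lt\<close> says exactly that the unknowns outnumber the
    equations.\<close>
  also have "\<dots> = (a + d) * b + (a + d) * (g - b)" using g
    by (metis add.commute add_diff_inverse_nat add_mult_distrib2 less_add_Suc1 mult.commute not_less_iff_gr_or_eq trans_less_add1 less_trans)
  also have "\<dots> < a * (g - b - d) + (a + d) * (g - b)" using lt by simp
  also have "\<dots> = card (IU <+> IV)"
    using fin by (simp add: card_Plus IU_def IV_def card_cartesian_product)
  finally obtain c where c: "\<exists>k\<in>IU <+> IV. c k \<noteq> 0"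
    "\<And>j. j \<in> G \<times> S \<Longrightarrow> (\<Sum>k\<in>IU <+> IV. T j k * c k) = 0"
    using underdetermined_system[of "G \<times> S" "IU <+> IV" T] G S fin by auto
  define U where "U = mkp (a + d) (g - b) (c \<circ> Inl)"
  define V where "V = mkp a (g - b - d) (c \<circ> Inr)"
  have dU: "degX U < a + d" "deg U < g - b"
    unfolding U_def using a0 g by (auto intro!: degX_mkp_less degree_mkp_less)
  have dV: "degX V < a" "deg V < g - b - d"
    unfolding V_def using a0 g by (auto intro!: degX_mkp_less degree_mkp_less)
  have col0: "colp U y + colp V y * f y = 0" if y: "y \<in> G" for y
  proof (rule poly_eq_0_many[OF S(1)])
    have "deg (colp U y) < a + d" using degree_colp_le[of U y] dU by simp
    moreover have "deg (colp V y * f y) < a + d"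
      using degree_mult_le[of "colp V y" "f y"] degree_colp_le[of V y] dV f[OF y] by linarith
    ultimately show "deg (colp U y + colp V y * f y) < card S"
      unfolding S by (rule degree_add_less)
  next
    fix s assume s: "s \<in> S"
    have "0 = (\<Sum>k\<in>IU <+> IV. T (y, s) k * c k)" using c(2)[of "(y, s)"] y s by simp
    also have "\<dots> = (\<Sum>k\<in>IU. T (y, s) (Inl k) * c (Inl k)) + (\<Sum>k\<in>IV. T (y, s) (Inr k) * c (Inr k))"
      using fin by (simp add: sum.Plus o_def)
    also have "\<dots> = ev U s y + ev V s y * poly (f y) s"
      by (simp add: U_def V_def ev_mkp T_def IU_def IV_def sum_distrib_left sum_distrib_right mult_ac)
    finally show "poly (colp U y + colp V y * f y) s = 0" by (simp add: poly_colp)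
  qed
  have UV: "U * D + V * M = 0"
  proof (rule colp_eq_0_many[OF G])
    have "deg (U * D) < g" using degree_mult_le[of U D] dU g by (simp add: b_def)
    moreover have "deg (V * M) < g" using degree_mult_le[of V M] dV g degM by (simp add: b_def)
    ultimately show "deg (U * D + V * M) < card G" unfolding g_def by (rule degree_add_less)
  next
    fix y assume y: "y \<in> G"
    have "colp (U * D + V * M) y = colp D y * (colp U y + colp V y * f y)"
      by (simp add: colp_add colp_mult eq[OF y] algebra_simps)
    then show "colp (U * D + V * M) y = 0" using col0[OF y] by simp
  qed
  then have "V * M = D * (- U)" by (simp add: algebra_simps add_eq_0_iff)
  then have "D dvd V * M" by (metis dvd_triv_left)
  then have "D dvd V" using cop coprime_dvd_mult_left_iff by blast
  have V0: "V = 0"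
  proof (rule ccontr)
    assume "V \<noteq> 0"
    then obtain k where "V = D * k" "k \<noteq> 0" using \<open>D dvd V\<close> by (auto elim!: dvdE)
    then show False using dV(1) D by (simp add: degX_mult a_def)
  qed
  with UV D have U0: "U = 0" by simp
  from c(1) show False
  proof (elim bexE PlusE)
    fix k j assume "c k \<noteq> 0" "k = Inl j" "j \<in> IU"
    then show False using mkp_nonzero[of j "a + d" "g - b" "c \<circ> Inl"] U0 by (simp add: U_def IU_def)
  next
    fix k j assume "c k \<noteq> 0" "k = Inr j" "j \<in> IV"
    then show False using mkp_nonzero[of j a "g - b - d" "c \<circ> Inr"] V0 by (simp add: V_def IV_def)
  qed
qed

lemma exists_lagrange_basis:
  fixes A :: "real set"
  assumes "finite A"
  obtains L where "\<And>x. x \<in> A \<Longrightarrow> deg (L x) < card A"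
    "\<And>x w. x \<in> A \<Longrightarrow> w \<in> A \<Longrightarrow> poly (L x) w = (if w = x then 1 else 0)"
proof
  define L where "L x = (\<Prod>z\<in>A - {x}. smult (1 / (x - z)) [:- z, 1:])" for x
  show "deg (L x) < card A" if "x \<in> A" for x
  proof -
    have "deg (L x) \<le> (\<Sum>z\<in>A - {x}. deg (smult (1 / (x - z)) [:- z, 1:]))"
      unfolding L_def using assms by (intro order_trans[OF degree_prod_sum_le]) auto
    also have "\<dots> \<le> (\<Sum>z\<in>A - {x}. 1)" by (intro sum_mono) auto
    also have "\<dots> = card (A - {x})" by simp
    also have "\<dots> < card A" using assms that by (rule card_Diff1_less)
    finally show ?thesis .
  qed
  show "poly (L x) w = (if w = x then 1 else 0)" if "x \<in> A" "w \<in> A" for x w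
    using assms that by (auto simp: L_def poly_prod diff_divide_distrib[symmetric] intro!: prod.neutral)
qed

section \<open>Motions on the moment curve\<close>

text \<open>Each vertex is represented by its parameter on the curve, so \<open>A\<close> is the
  vertex set and \<open>f x\<close> is the polynomial of the motion at the vertex
  \<open>x\<close>.\<close>

locale curve_motion =
  fixes A :: "real set" and f :: "real \<Rightarrow> real poly" and d :: nat
  assumes finA: "finite A"
    and deg_f: "\<And>x. x \<in> A \<Longrightarrow> deg (f x) \<le> d"
    and root_f: "\<And>x. x \<in> A \<Longrightarrow> poly (f x) x = 0"
begin

text \<open>The value tested is the strain of the pair; an error is a pair whose distance changes to
  first order.\<close>

definition er :: "real \<Rightarrow> real \<Rightarrow> bool" where
  "er x y \<longleftrightarrow> poly (f y) x + poly (f x) y \<noteq> 0"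

definition Er :: "(real \<times> real) set" where
  "Er = {(x, y) \<in> A \<times> A. er x y}"

definition er_deg :: "real \<Rightarrow> nat" where
  "er_deg x = card {z \<in> A. er x z}"

lemma er_sym: "er x y \<longleftrightarrow> er y x"
  by (simp add: er_def add.commute)

lemma er_irrefl: "x \<in> A \<Longrightarrow> \<not> er x x"
  by (simp add: er_def root_f)

lemma finite_Er: "finite Er"
  unfolding Er_def using finA by (auto intro: finite_subset[of _ "A \<times> A"])

text \<open>A polynomial vanishing on \<open>Er\<close> is an error locator: multiplied by it, the values
  \<open>poly (f y) x\<close> and \<open>- poly (f x) y\<close> coincide on the whole grid.\<close>

lemma error_locator_interpolant:
  assumes E: "\<And>x y. (x, y) \<in> Er \<Longrightarrow> ev E x y = 0"
    and dX: "degX E + d < card A" and dY: "deg E + d < card A"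
  obtains P where "\<And>y. y \<in> A \<Longrightarrow> colp P y = colp E y * f y"
    "\<And>x. x \<in> A \<Longrightarrow> rowp P x = - (rowp E x * f x)"
    "degX P \<le> degX E + d" "deg P \<le> deg E + d"
proof -
  obtain L where L: "\<And>x. x \<in> A \<Longrightarrow> deg (L x) < card A"
    "\<And>x w. x \<in> A \<Longrightarrow> w \<in> A \<Longrightarrow> poly (L x) w = (if w = x then 1 else 0)"
    using exists_lagrange_basis[OF finA] by blast
  \<comment> \<open>Lagrange interpolation in \<open>X\<close> of the prescribed rows.\<close>
  define P where "P = (\<Sum>x\<in>A. [:L x:] * swap [:- (rowp E x * f x):])"
  have ev_P: "ev P x y = (\<Sum>z\<in>A. poly (L z) x * poly (- (rowp E z * f z)) y)" for x y
    by (simp add: P_def)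
  have rowP: "rowp P x = - (rowp E x * f x)" if "x \<in> A" for x
  proof (rule poly_ext)
    fix y
    have "(\<Sum>z\<in>A. poly (L z) x * poly (- (rowp E z * f z)) y)
          = (\<Sum>z\<in>A. if z = x then poly (- (rowp E z * f z)) y else 0)"
      using that by (intro sum.cong) (auto simp: L(2))
    then show "poly (rowp P x) y = poly (- (rowp E x * f x)) y"
      using that finA by (simp add: poly_rowp ev_P)
  qed
  have dP: "deg P \<le> deg E + d"
    unfolding P_def
  proof (intro degree_sum_le finA)
    fix x assume x: "x \<in> A"
    have "deg ([:L x:] * swap [:- (rowp E x * f x):]) \<le> deg [:L x:] + deg (swap [:- (rowp E x * f x):])"
      by (rule degree_mult_le)
    also have "\<dots> = deg (rowp E x * f x)" using degX_const[of "- (rowp E x * f x)"] by (simp add: degX_def)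
    also have "\<dots> \<le> deg E + d"
      using degree_mult_le[of "rowp E x" "f x"] degree_rowp_le[of E x] deg_f[OF x] by linarith
    finally show "deg ([:L x:] * swap [:- (rowp E x * f x):]) \<le> deg E + d" .
  qed
  have dXP: "degX P \<le> card A - 1"
    unfolding P_def
  proof (intro degX_sum_le finA)
    fix x assume x: "x \<in> A"
    have "degX ([:L x:] * swap [:- (rowp E x * f x):]) \<le> degX [:L x:] + degX (swap [:- (rowp E x * f x):])"
      by (rule degX_mult_le)
    also have "\<dots> = deg (L x)" by (simp add: degX_const)
    finally show "degX ([:L x:] * swap [:- (rowp E x * f x):]) \<le> card A - 1" using L(1)[OF x] by linarith
  qed
  have colP: "colp P y = colp E y * f y" if y: "y \<in> A" for y
  proof -
    have "colp P y - colp E y * f y = 0"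
    proof (rule poly_eq_0_many[OF finA])
      have "deg (colp P y) < card A" using degree_colp_le[of P y] dXP dX by linarith
      moreover have "deg (colp E y * f y) < card A"
        using degree_mult_le[of "colp E y" "f y"] degree_colp_le[of E y] deg_f[OF y] dX by linarith
      ultimately show "deg (colp P y - colp E y * f y) < card A" by (rule degree_diff_less)
    next
      fix x assume x: "x \<in> A"
      have "ev P x y = - (ev E x y * poly (f x) y)"
        using rowP[OF x] by (metis poly_minus poly_mult poly_rowp)
      \<comment> \<open>At an error the factor \<open>E\<close> vanishes; elsewhere the two values
        agree.\<close>
      also have "\<dots> = ev E x y * poly (f y) x"
        using E[of x y] x y by (cases "er x y") (auto simp: Er_def er_def algebra_simps add_eq_0_iff)
      finally show "poly (colp P y - colp E y * f y) x = 0" by (simp add: poly_colp)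
    qed
    then show ?thesis by simp
  qed
  \<comment> \<open>For \<open>j > degX E + d\<close> the coefficient of \<open>X^j\<close> is a
    polynomial in \<open>Y\<close> of degree below \<open>card A\<close>. It vanishes on
    \<open>A\<close>, since the columns of \<open>P\<close> there have low degree.\<close>
  have "degX P \<le> degX E + d"
    unfolding degX_def[of P]
  proof (rule degree_le, intro allI impI)
    fix j assume j: "j > degX E + d"
    show "coeff (swap P) j = 0"
    proof (rule poly_eq_0_many[OF finA])
      have "degX (swap P) \<le> deg P" by simp
      then have "deg (coeff (swap P) j) \<le> deg P" by (simp only: degX_le_iff)
      then show "deg (coeff (swap P) j) < card A" using dP dY by linarith
    next
      fix y assume y: "y \<in> A"
      have "deg (colp P y) \<le> degX E + d"
        using colP[OF y] degree_mult_le[of "colp E y" "f y"] degree_colp_le[of E y] deg_f[OF y] by simp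
      then show "poly (coeff (swap P) j) y = 0"
        using j coeff_colp[of P y j] by (simp add: coeff_eq_0)
    qed
  qed
  with that rowP colP dP show ?thesis by blast
qed

text \<open>In every column of \<open>A\<close> both sides equal
  \<open>colp E y * colp E' y * f y\<close>, and their degree in \<open>Y\<close> is below
  \<open>card A\<close>. Thus the fraction \<open>P / E\<close> does not depend on the
  locator.\<close>

lemma interpolants_proportional:
  assumes "\<And>y. y \<in> A \<Longrightarrow> colp P y = colp E y * f y" "\<And>y. y \<in> A \<Longrightarrow> colp P' y = colp E' y * f y"
    and "deg P \<le> deg E + d" "deg P' \<le> deg E' + d" "deg E + deg E' + d < card A"
  shows "E * P' = E' * P"
proof -
  have "E * P' - E' * P = 0"
  proof (rule colp_eq_0_many[OF finA])
    have "deg (E * P') < card A" "deg (E' * P) < card A"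
      using degree_mult_le[of E P'] degree_mult_le[of E' P] assms by linarith+
    then show "deg (E * P' - E' * P) < card A" by (rule degree_diff_less)
  next
    fix y assume "y \<in> A"
    then show "colp (E * P' - E' * P) y = 0" by (simp add: colp_diff colp_mult assms(1,2))
  qed
  then show ?thesis by simp
qed

text \<open>Let \<open>h = Q + swap Q\<close>. Among the points with \<open>f x = colp Q x\<close>, the errors are the pairs at which
  \<open>h\<close> does not vanish, and these are too many if \<open>h \<noteq> 0\<close>. If \<open>h = 0\<close>, then \<open>Q\<close> is a trivial motion, and subtracting it
  leaves fewer than half of the \<open>f x\<close> nonzero.\<close>

lemma no_er_if_mostly_polynomial:
  assumes ore: "\<And>x y. x \<in> A \<Longrightarrow> y \<in> A \<Longrightarrow> er x y \<Longrightarrow> er_deg x + er_deg y + 3 * d \<le> card A + 1"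
    and d: "d \<ge> 1" and dXQ: "degX Q \<le> d" and dQ: "deg Q \<le> d"
    and few: "2 * card {y \<in> A. f y \<noteq> colp Q y} + 2 * d \<le> card A + 1"
    and n: "3 * d < card A" and x: "x \<in> A" and y: "y \<in> A"
  shows "\<not> er x y"
proof -
  define Y where "Y = {y \<in> A. f y = colp Q y}"
  define Z where "Z = {y \<in> A. f y \<noteq> colp Q y}"
  have fin: "finite Y" "finite Z" using finA by (auto simp: Y_def Z_def)
  have YZ: "A = Y \<union> Z" "Y \<inter> Z = {}" by (auto simp: Y_def Z_def)
  have card_A: "card A = card Y + card Z"
    unfolding YZ(1) using fin YZ(2) by (intro card_Un_disjoint)
  have few': "2 * card Z + 2 * d \<le> card A + 1" using few by (simp add: Z_def)
  define h where "h = Q + swap Q"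
  have ev_h: "ev h s t = ev Q s t + ev Q t s" for s t by (simp add: h_def)
  show ?thesis
  proof (cases "h = 0")
    case False
    have er_h: "er s t \<longleftrightarrow> ev h s t \<noteq> 0" if "s \<in> Y" "t \<in> Y" for s t
      using that by (auto simp: er_def Y_def ev_h poly_colp)
    have dh: "deg h \<le> d" "degX h \<le> d"
      unfolding h_def using dXQ dQ 
      by (auto intro!: degree_add_le degX_add_le simp: degX_def[symmetric])
    \<comment> \<open>A nonzero column of \<open>h\<close> has at most \<open>d\<close> roots, and
      every other point of \<open>Y\<close> forms an error with \<open>v\<close>.\<close>
    have big: "card Y - d \<le> er_deg v" if v: "v \<in> Y" "colp h v \<noteq> 0" for v
    proof -
      have "card {w. poly (colp h v) w = 0} \<le> d"
        using card_poly_roots_bound[OF v(2)] degree_colp_le[of h v] dh by linarith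
      moreover have "finite {w. poly (colp h v) w = 0}" using v(2) by (rule poly_roots_finite)
      ultimately have "card (Y - {w. poly (colp h v) w = 0}) \<ge> card Y - d"
        using diff_card_le_card_Diff[of "{w. poly (colp h v) w = 0}" Y] by linarith
      moreover have "Y - {w. poly (colp h v) w = 0} \<subseteq> {z \<in> A. er v z}"
      proof
        fix w assume "w \<in> Y - {w. poly (colp h v) w = 0}"
        then have "w \<in> Y" "ev h w v \<noteq> 0" by (auto simp: poly_colp)
        then have "er v w" using er_h[of w v] er_sym[of w v] v by simp
        then show "w \<in> {z \<in> A. er v z}" using \<open>w \<in> Y\<close> by (simp add: Y_def)
      qed
      moreover have "finite {z \<in> A. er v z}" using finA by simp
      ultimately show ?thesis unfolding er_deg_def by (meson card_mono order_trans)
    qed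
    have "\<exists>v\<in>Y. colp h v \<noteq> 0"
    proof (rule ccontr)
      assume "\<not> ?thesis"
      moreover have "deg h < card Y" using dh few' card_A n d by linarith
      ultimately have "h = 0" using colp_eq_0_many[OF fin(1)] by blast
      with False show False by simp
    qed
    then obtain v where v: "v \<in> Y" "colp h v \<noteq> 0" by blast
    have "\<exists>w\<in>Y. poly (colp h v) w \<noteq> 0"
    proof (rule ccontr)
      assume "\<not> ?thesis"
      moreover have "deg (colp h v) < card Y" using degree_colp_le[of h v] dh few' card_A n d by linarith
      ultimately have "colp h v = 0" using poly_eq_0_many[OF fin(1)] by blast
      with v show False by simp
    qed
    then obtain w where w: "w \<in> Y" "ev h w v \<noteq> 0" by (auto simp: poly_colp)
    then have "poly (colp h w) v \<noteq> 0" using ev_h by (simp add: poly_colp add.commute)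
    then have "colp h w \<noteq> 0" by auto
    \<comment> \<open>With \<open>ore\<close> this gives \<open>card Y + d <= card Z + 1\<close>,
      whereas \<open>few'\<close> gives \<open>card Z + 2 * d <= card Y + 1\<close>.\<close>
    from big[OF v] big[OF w(1) this] have "2 * (card Y - d) \<le> er_deg w + er_deg v" by linarith
    moreover have "er w v" using w v er_h by simp
    then have "er_deg w + er_deg v + 3 * d \<le> card A + 1" using ore w v YZ by blast
    ultimately show ?thesis using few' card_A d by linarith
  next
    case True
    define g where "g v = f v - colp Q v" for v
    have anti: "ev Q s t + ev Q t s = 0" for s t using ev_h[of s t] True by simp
    have er_g: "er s t \<longleftrightarrow> poly (g t) s + poly (g s) t \<noteq> 0" for s t
      using anti[of s t] by (simp add: er_def g_def poly_colp algebra_simps)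
    have gY: "g v = 0" if "v \<in> Y" for v using that by (simp add: g_def Y_def)
    \<comment> \<open>On \<open>Y\<close> the strain with \<open>z\<close> reduces to a value of
      \<open>g z\<close>. One of the at most \<open>d\<close> roots of \<open>g z\<close> is
      \<open>z\<close> itself, which is not in \<open>Y\<close>; hence \<open>d - 1\<close>.\<close>
    have non: "card {v \<in> Y. \<not> er z v} \<le> d - 1" if z: "z \<in> Z" for z
    proof -
      have g0: "g z \<noteq> 0" using z by (simp add: g_def Z_def)
      have "deg (g z) \<le> d" unfolding g_def using z YZ deg_f degree_colp_le[of Q z] dXQ
        by (intro degree_diff_le) auto
      then have "card {v. poly (g z) v = 0} \<le> d" using card_poly_roots_bound[OF g0] by linarith
      moreover have "insert z {v \<in> Y. \<not> er z v} \<subseteq> {v. poly (g z) v = 0}"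
        using gY er_g z YZ root_f anti[of z z] by (auto simp: g_def poly_colp)
      ultimately have "card (insert z {v \<in> Y. \<not> er z v}) \<le> d"
        using poly_roots_finite[OF g0] by (meson card_mono order_trans)
      moreover have "card (insert z {v \<in> Y. \<not> er z v}) = Suc (card {v \<in> Y. \<not> er z v})"
        using fin z YZ by (intro card_insert_disjoint) auto
      ultimately show ?thesis by simp
    qed
    have degZ: "card Y - (d - 1) \<le> er_deg z" if z: "z \<in> Z" for z
    proof -
      have "card Y = card {v \<in> Y. \<not> er z v} + card {v \<in> Y. er z v}"
        using fin by (subst card_Un_disjoint[symmetric]) (auto intro!: arg_cong[where f = card])
      moreover have "card {v \<in> Y. er z v} \<le> er_deg z"
        unfolding er_deg_def using finA YZ by (intro card_mono) auto
      ultimately show ?thesis using non[OF z] by linarith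
    qed
    have "Z = {}"
    proof (rule ccontr)
      assume Zne: "Z \<noteq> {}"
      have cY: "card Y \<ge> card Z" "card Y > 0" "card Z > 0" "card Y \<ge> d"
        using few' card_A n d Zne fin by (auto simp: card_gt_0_iff)
      have er1: "er_deg v \<ge> 1" if "er z v" "z \<in> A" for z v
      proof -
        have "z \<in> {z \<in> A. er v z}" using that er_sym by auto
        moreover have "finite {z \<in> A. er v z}" using finA by simp
        ultimately have "card {z \<in> A. er v z} > 0" using card_gt_0_iff by blast
        then show ?thesis by (simp add: er_deg_def)
      qed
      show False
      \<comment> \<open>For small \<open>Z\<close>, one error between \<open>Z\<close> and
        \<open>Y\<close> contradicts \<open>ore\<close> by the bound \<open>degZ\<close>. For large
        \<open>Z\<close>, the point of \<open>Y\<close> must have many errors in \<open>Z\<close> as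
        well.\<close>
      proof (cases "card Z \<le> 2 * d")
        case True
        from Zne obtain z where z: "z \<in> Z" by blast
        have "{v \<in> Y. er z v} \<noteq> {}"
        proof
          assume "{v \<in> Y. er z v} = {}"
          then have "{v \<in> Y. \<not> er z v} = Y" by auto
          then show False using non[OF z] cY d by simp
        qed
        then obtain v where v: "v \<in> Y" "er z v" by blast
        have "er_deg z + er_deg v + 3 * d \<le> card A + 1" using ore[of z v] z v YZ by blast
        then show False using degZ[OF z] er1[of z v] v z YZ card_A True cY n d by auto
      next
        case False
        \<comment> \<open>Double counting of the error-free pairs between \<open>Y\<close> and
          \<open>Z\<close>: there are at most \<open>card Z * (d - 1)\<close>, and
          \<open>card Z <= card Y\<close>.\<close>
        have "\<exists>v\<in>Y. card {z \<in> Z. \<not> er z v} < d"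
        proof (rule ccontr)
          assume "\<not> ?thesis"
          then have "(\<Sum>v\<in>Y. d) \<le> (\<Sum>v\<in>Y. card {z \<in> Z. \<not> er z v})" by (intro sum_mono) auto
          also have "\<dots> = (\<Sum>z\<in>Z. card {v \<in> Y. \<not> er z v})"
            using fin by (intro sum_multicount_gen) auto
          also have "\<dots> \<le> (\<Sum>z\<in>Z. d - 1)" by (intro sum_mono non)
          finally have "card Y * d \<le> card Z * (d - 1)" by simp
          also have "\<dots> \<le> card Y * (d - 1)" using cY by simp
          finally show False using cY d by simp
        qed
        then obtain v where v: "v \<in> Y" "card {z \<in> Z. \<not> er z v} < d" by blast
        have "card Z = card {z \<in> Z. \<not> er z v} + card {z \<in> Z. er z v}"
          using fin by (subst card_Un_disjoint[symmetric]) (auto intro!: arg_cong[where f = card])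
        then have 1: "card {z \<in> Z. er z v} \<ge> card Z - (d - 1)" using v by linarith
        then have "{z \<in> Z. er z v} \<noteq> {}" using False by (intro notI) simp
        then obtain z where z: "z \<in> Z" "er z v" by blast
        have "{z \<in> Z. er z v} \<subseteq> {z \<in> A. er v z}" using YZ er_sym by auto
        then have 2: "card {z \<in> Z. er z v} \<le> er_deg v"
          unfolding er_deg_def using finA by (intro card_mono) auto
        have "er_deg z + er_deg v + 3 * d \<le> card A + 1" using ore[of z v] z v YZ by blast
        then show False using degZ[OF z(1)] 1 2 card_A cY d False by linarith
      qed
    qed
    then show ?thesis using gY er_g x y YZ by simp
  qed
qed

end

section \<open>The common denominator of the error locators\<close>

lemma finite_colp_roots: "p \<noteq> 0 \<Longrightarrow> finite {t. colp p t = 0}"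
proof (rule ccontr)
  assume p: "p \<noteq> 0" and "infinite {t. colp p t = 0}"
  then obtain T where "T \<subseteq> {t. colp p t = 0}" "finite T" "card T = Suc (deg p)"
    using infinite_arbitrarily_large by blast
  then show False using p colp_eq_0_many[of T p] by auto
qed

lemma exists_finite_avoiding:
  assumes "finite (B :: real set)"
  obtains T where "finite T" "card T = k" "T \<inter> B = {}"
proof -
  have "infinite (- B)" using assms infinite_UNIV_char_0 by (simp add: Compl_eq_Diff_UNIV)
  then obtain T where "T \<subseteq> - B" "finite T" "card T = k"
    using infinite_arbitrarily_large by blast
  then show ?thesis using that by blast
qed

text \<open>\<open>T\<close> avoids the finitely many zero columns of \<open>D\<close>, then
  \<open>S\<close> avoids the roots of the columns over \<open>T\<close>. On such a grid a multiple
  of \<open>D\<close> vanishes only where its cofactor does.\<close>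

lemma exists_nonvanishing_grid:
  assumes D: "D \<noteq> 0" and B: "finite B"
  obtains S T where "finite S" "card S = r" "S \<inter> B = {}" "finite T" "card T = q" "T \<inter> B = {}"
    "\<And>s t. s \<in> S \<Longrightarrow> t \<in> T \<Longrightarrow> ev D s t \<noteq> 0"
proof -
  obtain T where T: "finite T" "card T = q" "T \<inter> (B \<union> {t. colp D t = 0}) = {}"
    using exists_finite_avoiding[of "B \<union> {t. colp D t = 0}"] B finite_colp_roots[OF D] by blast
  have "finite (B \<union> (\<Union>t\<in>T. {s. poly (colp D t) s = 0}))"
    using B T by (intro finite_UnI finite_UN_I) (auto intro!: poly_roots_finite)
  then obtain S where "finite S" "card S = r" "S \<inter> (B \<union> (\<Union>t\<in>T. {s. poly (colp D t) s = 0})) = {}"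
    by (rule exists_finite_avoiding[where k = r]) blast
  with T show ?thesis by (intro that[of S T]) (auto simp: poly_colp)
qed

text \<open>Here \<open>a\<close> and \<open>b\<close> are the degrees of the common denominator in
  \<open>X\<close> and \<open>Y\<close>; by \<open>I\<close> and \<open>II\<close> both are
  positive. Multiplying \<open>I\<close> and \<open>II\<close> yields
  \<open>r * q <= d * (b1 + d)\<close>. With \<open>dim\<close> and
  \<open>2 * b1 <= N + 1 - d\<close> this leaves
  \<open>(d - 2) * N + 3 * d * (d - 1) <= 0\<close>.\<close>

lemma degree_bound_contradiction:
  fixes N d b1 e a b r q :: int
  assumes d: "d \<ge> 2" and N: "N > 0" and e: "2 * e \<le> (N + d) * (N + 1 - 2 * d)"
    and b1: "N * b1 \<le> e" and dim: "N * (N - b1) \<le> e + r * q"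
    and ab: "a \<ge> 0" "b \<ge> 0" "b \<le> b1" "a > 0 \<or> b > 0" and rq: "r > 0" "q > 0"
    and I: "a * (b1 + q) \<le> (a + d) * b" and II: "b * r \<le> (b + d) * a"
  shows False
proof -
  have a: "a > 0"
  proof (rule ccontr)
    assume "\<not> a > 0"
    then have "a = 0" "b > 0" using ab by auto
    then show False using II rq by (simp add: mult_le_0_iff)
  qed
  have b: "b > 0"
  proof (rule ccontr)
    assume "\<not> b > 0"
    then have "b = 0" using ab by auto
    then have "a * (b1 + q) \<le> 0" using I by simp
    moreover have "b1 + q > 0" using ab \<open>b = 0\<close> rq by linarith
    ultimately show False using a by (simp add: mult_le_0_iff)
  qed
  have "a * q \<le> (a + d) * b - a * b1" using I by (simp add: algebra_simps)
  also have "\<dots> \<le> d * b"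
  proof -
    have "a * b \<le> a * b1" using ab a by (intro mult_left_mono) auto
    then show ?thesis by (simp add: algebra_simps)
  qed
  finally have aq: "a * q \<le> d * b" .
  have "(b * r) * (a * q) \<le> ((b + d) * a) * (d * b)"
    by (rule mult_mono[OF II aq]) (use a b rq d in auto)
  then have "(a * b) * (r * q) \<le> (a * b) * (d * (b + d))" by (simp add: algebra_simps)
  then have "r * q \<le> d * (b + d)" using a b by (simp add: mult_le_cancel_left_pos)
  also have "\<dots> \<le> d * (b1 + d)" using ab d by (intro mult_left_mono) auto
  finally have rq': "r * q \<le> d * (b1 + d)" .
  have "(N + d) * (N + 1 - 2 * d) = N * (N + 1 - d) - (2 * d * d - d)" by (simp add: algebra_simps)
  moreover have "2 * d * d - d \<ge> 0" using d by (simp add: algebra_simps)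
  ultimately have "N * (2 * b1) \<le> N * (N + 1 - d)" using e b1 by (simp add: algebra_simps)
  then have b1': "2 * b1 \<le> N + 1 - d" using N by (simp add: mult_le_cancel_left_pos)
  have "d * (2 * b1) \<le> d * (N + 1 - d)" using b1' d by (intro mult_left_mono) auto
  moreover have "N * N - 2 * e \<le> d * (b1 + d)"
    using dim b1 rq' by (simp add: algebra_simps)
  ultimately have "2 * (N * N) - 2 * ((N + d) * (N + 1 - 2 * d)) \<le> d * (N + 1 - d) + 2 * d * d"
    using e by (simp add: algebra_simps)
  then have "(d - 2) * N + 3 * d * (d - 1) \<le> 0" by (simp add: algebra_simps)
  moreover have "(d - 2) * N \<ge> 0" "3 * d * (d - 1) > 0" using d N by auto
  ultimately show False by linarith
qed

context curve_motion begin

text \<open>\<open>W\<close> is the space of error locators of bidegree less than \<open>(N, \<beta>)\<close>. The quotient of interpolant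
  and locator is the same fraction \<open>M / D\<close> for all of them, so the reduced denominator \<open>D\<close>
  divides every locator. The lower bound on the dimension of \<open>W\<close> forces \<open>D\<close> to be constant.\<close>

lemma mostly_polynomial:
  assumes d: "d \<ge> 2" and n: "3 * d < card A"
    and size: "2 * card Er + 3 * d * card A \<le> card A * (card A + 1)"
  obtains Q where "degX Q \<le> d" "deg Q \<le> d"
    "2 * card {y \<in> A. f y \<noteq> colp Q y} + 2 * d \<le> card A + 1"
proof -
  \<comment> \<open>Locators have degree below \<open>N\<close> in \<open>X\<close>, so that adding
    \<open>d\<close> stays below \<open>n\<close>. The least degree in \<open>Y\<close> at which the
    \<open>N * (b1 + 1)\<close> coefficients outnumber the \<open>e\<close> errors is
    \<open>b1\<close>. Degrees at most \<open>b1\<close> and below \<open>\<beta>\<close> together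
    are small enough for \<open>interpolants_proportional\<close>.\<close>
  define n N e where "n = card A" and "N = n - d" and "e = card Er"
  define b1 where "b1 = e div N"
  define \<beta> where "\<beta> = N - b1"
  have nN: "n = N + d" "N > 2 * d" using assms(2) by (auto simp: n_def N_def)
  have Nb1: "N * b1 \<le> e" "e < N * (b1 + 1)"
    using nN by (auto simp: b1_def dividend_less_times_div) 
  have e: "2 * int e \<le> (int N + int d) * (int N + 1 - 2 * int d)"
  proof -
    have "2 * e + 3 * d * n \<le> n * (n + 1)" using size by (simp add: e_def n_def)
    then have "int (2 * e + 3 * d * n) \<le> int (n * (n + 1))" by (simp only: of_nat_le_iff)
    then show ?thesis by (simp add: nN(1) algebra_simps)
  qed
  have b1_le: "2 * b1 + d \<le> N + 1"
  proof -
    have "int N * int b1 \<le> int e" using Nb1(1) by (metis of_nat_le_iff of_nat_mult)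
    moreover have "(int N + int d) * (int N + 1 - 2 * int d) = int N * (int N + 1 - int d) - (2 * int d * int d - int d)"
      by (simp add: algebra_simps)
    moreover have "2 * int d * int d - int d \<ge> 0" using d by (simp add: algebra_simps)
    ultimately have "int N * (2 * int b1) \<le> int N * (int N + 1 - int d)" using e by (simp add: algebra_simps)
    then have "2 * int b1 \<le> int N + 1 - int d" using nN by (simp add: mult_le_cancel_left_pos)
    then show ?thesis by linarith
  qed
  have \<beta>: "b1 < \<beta>" "b1 + \<beta> = N" using b1_le d by (auto simp: \<beta>_def)
  define W where "W E \<longleftrightarrow> degX E < N \<and> deg E < \<beta> \<and> (\<forall>x y. (x, y) \<in> Er \<longrightarrow> ev E x y = 0)" for E
  have interp: "\<exists>P. (\<forall>y\<in>A. colp P y = colp E y * f y) \<and> (\<forall>x\<in>A. rowp P x = - (rowp E x * f x)) \<and>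
      degX P \<le> degX E + d \<and> deg P \<le> deg E + d" if "W E" for E
    using error_locator_interpolant[of E] that nN \<beta> unfolding W_def n_def[symmetric]
    by (smt (verit, best) add_less_mono1 le_add2 order_less_le_trans)
  have W_mkp: "W (mkp N b c)" "deg (mkp N b c) < b"
    if "\<And>x y. (x, y) \<in> Er \<Longrightarrow> ev (mkp N b c) x y = 0" "0 < b" "b \<le> \<beta>" for b c
    using that degX_mkp_less[of N b c] degree_mkp_less[of b N c] nN by (auto simp: W_def)
  obtain c1 where c1: "\<exists>k\<in>{..<N} \<times> {..<b1 + 1}. c1 k \<noteq> 0"
    "\<And>x y. (x, y) \<in> Er \<Longrightarrow> ev (mkp N (b1 + 1) c1) x y = 0"
    using underdetermined_system[of Er "{..<N} \<times> {..<b1 + 1}" "\<lambda>(x, y) k. x ^ fst k * y ^ snd k"]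
      finite_Er Nb1 unfolding e_def[symmetric]
    by (fastforce simp: card_cartesian_product ev_mkp mult.commute)
  define E1 where "E1 = mkp N (b1 + 1) c1"
  have E1: "W E1" "deg E1 \<le> b1" "E1 \<noteq> 0"
    using W_mkp[OF c1(2)] \<beta> c1(1) mkp_nonzero unfolding E1_def by fastforce+
  obtain P1 where P1: "\<And>y. y \<in> A \<Longrightarrow> colp P1 y = colp E1 y * f y" "degX P1 \<le> degX E1 + d" "deg P1 \<le> deg E1 + d"
    using interp[OF E1(1)] by blast
  \<comment> \<open>Reduction of the fraction \<open>P1 / E1\<close> to lowest terms
    \<open>M / D\<close>.\<close>
  define g where "g = gcd E1 P1"
  have g0: "g \<noteq> 0" using E1 by (simp add: g_def)
  then obtain D M where DM: "E1 = D * g" "P1 = M * g" "coprime D M"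
    using gcd_coprime_exists[of E1 P1] unfolding g_def by blast
  have D0: "D \<noteq> 0" using E1 DM by auto
  define a b where "a = degX D" and "b = deg D"
  have degM: "degX M \<le> a + d" "deg M \<le> b + d"
    using P1(2,3) DM D0 g0 by (cases "M = 0"; simp add: degX_mult degree_mult_eq a_def b_def)+
  \<comment> \<open>The rows and columns in which the fraction \<open>M / D\<close> fails to
    reproduce the data; there the cofactor of \<open>D\<close> in every locator must vanish.\<close>
  define Xb where "Xb = {x \<in> A. rowp M x \<noteq> - (rowp D x * f x)}"
  define Yb where "Yb = {y \<in> A. colp M y \<noteq> colp D y * f y}"
  have finb: "finite Xb" "finite Yb" using finA by (auto simp: Xb_def Yb_def)
  have factor: "\<exists>k. E = D * k \<and> (\<forall>y\<in>Yb. colp k y = 0) \<and> (\<forall>x\<in>Xb. rowp k x = 0)" if E: "W E" for E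
  proof -
    obtain P where P: "\<And>y. y \<in> A \<Longrightarrow> colp P y = colp E y * f y"
      "\<And>x. x \<in> A \<Longrightarrow> rowp P x = - (rowp E x * f x)" "deg P \<le> deg E + d"
      using interp[OF E] by blast
    have "E1 * P = E * P1"
      using E1 E P1 P \<beta> nN by (intro interpolants_proportional) (auto simp: W_def n_def[symmetric])
    then have DP: "D * P = E * M" using DM g0 by simp
    then have "D dvd E * M" by (metis dvd_triv_left)
    then have "D dvd E" using DM(3) coprime_dvd_mult_left_iff by blast
    then obtain k where k: "E = D * k" by (auto elim!: dvdE)
    then have Pk: "P = k * M" using DP D0 by simp
    have "colp k y = 0" if y: "y \<in> Yb" for y
    proof -
      have "colp k y * colp M y = colp k y * (colp D y * f y)"
        using P(1)[of y] y by (simp add: Pk k colp_mult Yb_def mult_ac)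
      then show ?thesis using y by (simp add: Yb_def)
    qed
    moreover have "rowp k x = 0" if x: "x \<in> Xb" for x
    proof -
      have "rowp k x * rowp M x = rowp k x * (- (rowp D x * f x))"
        using P(2)[of x] x by (simp add: Pk k rowp_mult Xb_def mult_ac)
      then show ?thesis using x by (simp only: mult_cancel_left Xb_def mem_Collect_eq) blast
    qed
    ultimately show ?thesis using k by blast
  qed
  have bad: "a + card Xb < N" "b + card Yb \<le> b1"
  proof -
    obtain k where k: "E1 = D * k" "\<forall>y\<in>Yb. colp k y = 0" "\<forall>x\<in>Xb. rowp k x = 0"
      using factor[OF E1(1)] by blast
    have k0: "k \<noteq> 0" using k E1 by auto
    have "card Xb \<le> degX k" using k0 k(3) finb rowp_eq_0_many[of Xb k] by fastforce
    moreover have "card Yb \<le> deg k" using k0 k(2) finb colp_eq_0_many[of Yb k] by fastforce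
    moreover have "degX E1 = a + degX k" "deg E1 = b + deg k"
      using k D0 k0 by (simp_all add: a_def b_def degX_mult degree_mult_eq)
    ultimately show "a + card Xb < N" "b + card Yb \<le> b1" using E1 by (auto simp: W_def)
  qed
  \<comment> \<open>A cofactor has bidegree less than \<open>(N - a, \<beta> - b)\<close> and
    vanishes on \<open>card Xb\<close> rows and \<open>card Yb\<close> columns, which leaves at most
    \<open>r * q\<close> degrees of freedom.\<close>
  define r q where "r = N - a - card Xb" and "q = \<beta> - b - card Yb"
  have rq: "r > 0" "q > 0" using bad \<beta> by (auto simp: r_def q_def)
  \<comment> \<open>The space of locators has dimension at least \<open>N * \<beta> - e\<close>. If
    this exceeded \<open>r * q\<close>, some nonzero locator would also vanish on the grid
    \<open>S \<times> T\<close>, which forces its cofactor to be zero.\<close>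
  have dim: "N * \<beta> \<le> e + r * q"
  proof (rule ccontr)
    assume less: "\<not> ?thesis"
    obtain S T where ST: "finite S" "card S = r" "S \<inter> A = {}" "finite T" "card T = q" "T \<inter> A = {}"
      "\<And>s t. s \<in> S \<Longrightarrow> t \<in> T \<Longrightarrow> ev D s t \<noteq> 0"
      using exists_nonvanishing_grid[OF D0 finA] by blast
    have "card (Er \<union> S \<times> T) \<le> e + r * q"
      using card_Un_le[of Er "S \<times> T"] ST by (simp add: e_def card_cartesian_product)
    then have "card (Er \<union> S \<times> T) < card ({..<N} \<times> {..<\<beta>})"
      using less by (simp add: card_cartesian_product)
    then obtain c where c: "\<exists>k\<in>{..<N} \<times> {..<\<beta>}. c k \<noteq> 0"
      "\<forall>z\<in>Er \<union> S \<times> T. (\<Sum>k\<in>{..<N} \<times> {..<\<beta>}. fst z ^ fst k * snd z ^ snd k * c k) = 0"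
      using underdetermined_system[of "Er \<union> S \<times> T" "{..<N} \<times> {..<\<beta>}" "\<lambda>z k. fst z ^ fst k * snd z ^ snd k"]
        finite_Er ST by auto
    have c0: "ev (mkp N \<beta> c) x y = 0" if "(x, y) \<in> Er \<union> S \<times> T" for x y
      using bspec[OF c(2) that] by (simp add: ev_mkp mult.commute)
    define E where "E = mkp N \<beta> c"
    have E: "W E" "E \<noteq> 0" using W_mkp(1)[of \<beta> c] c0 c(1) \<beta> mkp_nonzero unfolding E_def by auto
    obtain k where k: "E = D * k" "\<forall>y\<in>Yb. colp k y = 0" "\<forall>x\<in>Xb. rowp k x = 0"
      using factor[OF E(1)] by blast
    have k0: "k \<noteq> 0" using k E by auto
    have degk: "degX k < N - a" "deg k < \<beta> - b"
      using E k D0 k0 by (auto simp: W_def a_def b_def degX_mult degree_mult_eq)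
    have "colp k t = 0" if t: "t \<in> T" for t
    proof (rule poly_eq_0_many)
      show "finite (S \<union> Xb)" using ST finb by simp
      have "card (S \<union> Xb) = r + card Xb"
        using ST finb by (subst card_Un_disjoint) (auto simp: Xb_def)
      then show "deg (colp k t) < card (S \<union> Xb)"
        using degree_colp_le[of k t] degk bad by (simp add: r_def)
    next
      fix s assume s: "s \<in> S \<union> Xb"
      show "poly (colp k t) s = 0"
      proof (cases "s \<in> S")
        case True
        then have "ev E s t = 0" using c0 t by (simp add: E_def)
        then show ?thesis using ST(7)[OF True t] by (simp add: k(1) poly_colp)
      next
        case False
        then have "rowp k s = 0" using s k by blast
        then show ?thesis by (metis poly_0 poly_colp poly_rowp)
      qed
    qed
    then have "k = 0"
    proof (intro colp_eq_0_many[of "T \<union> Yb" k])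
      have "card (T \<union> Yb) = q + card Yb"
        using ST finb by (subst card_Un_disjoint) (auto simp: Yb_def)
      then show "deg k < card (T \<union> Yb)" using degk bad \<beta> by (simp add: q_def)
    qed (use ST finb k in auto)
    with k0 show False by simp
  qed
  have cardA: "card (A - Xb) = n - card Xb" "card (A - Yb) = n - card Yb"
    using finb by (auto simp: n_def Xb_def Yb_def intro!: card_Diff_subset)
  have "a * (card (A - Yb) - b - d) \<le> (a + d) * b"
    unfolding a_def b_def
  proof (rule syzygy_count[where f = f and M = M])
    show "colp M y = colp D y * f y" if "y \<in> A - Yb" for y using that by (auto simp: Yb_def)
  qed (use finA D0 DM deg_f degM in \<open>auto simp: b_def\<close>)
  moreover have "card (A - Yb) - b - d = b1 + q" using cardA nN \<beta> bad by (simp add: q_def)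
  ultimately have I: "a * (b1 + q) \<le> (a + d) * b" by simp
  \<comment> \<open>Rows are the columns after \<open>swap\<close>, with \<open>- f\<close> in place
    of \<open>f\<close>.\<close>
  have "degX (swap D) * (card (A - Xb) - deg (swap D) - d) \<le> (degX (swap D) + d) * deg (swap D)"
  proof (rule syzygy_count[where f = "\<lambda>x. - f x" and M = "swap M"])
    show "colp (swap M) x = colp (swap D) x * - f x" if "x \<in> A - Xb" for x using that by (auto simp: Xb_def)
    show "coprime (swap D) (swap M)" using DM by (intro coprime_swap)
    show "deg (swap M) \<le> deg (swap D) + d" using degM by (simp add: a_def flip: degX_def)
  qed (use finA D0 deg_f in auto)
  moreover have "card (A - Xb) - a - d = r" using cardA nN bad by (simp add: r_def)
  ultimately have II: "b * r \<le> (b + d) * a"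
    by (simp add: a_def b_def flip: degX_def)
  have "a = 0 \<and> b = 0"
  proof (rule ccontr)
    assume "\<not> ?thesis"
    then have "int a > 0 \<or> int b > 0" by auto
    moreover have "int N * (int N - int b1) \<le> int e + int r * int q"
    proof -
      have "int (N * \<beta>) \<le> int (e + r * q)" using dim by (simp only: of_nat_le_iff)
      then show ?thesis using \<beta> by (simp add: \<beta>_def of_nat_diff)
    qed
    moreover have "int N * int b1 \<le> int e" using Nb1(1) by (metis of_nat_le_iff of_nat_mult)
    moreover have "int a * (int b1 + int q) \<le> (int a + int d) * int b" 
      using I by (metis of_nat_add of_nat_le_iff of_nat_mult)
    moreover have "int b * int r \<le> (int b + int d) * int a"
      using II by (metis of_nat_add of_nat_le_iff of_nat_mult)
    ultimately show False
      using degree_bound_contradiction[of "int d" "int N" "int e" "int b1" "int r" "int q" "int a" "int b"]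
        d nN e bad rq by auto
  qed
  then have ab: "degX D = 0" "deg D = 0" by (simp_all add: a_def b_def)
  then obtain u where u: "D = [:u:]" by (metis degree_eq_zeroE)
  with ab have "deg u = 0" by (simp add: degX_const)
  then obtain v where v: "u = [:v:]" by (metis degree_eq_zeroE)
  have v0: "v \<noteq> 0" using D0 u v by auto
  define Q where "Q = Polynomial.smult [:1 / v:] M"
  have DQ: "M = D * Q" using v0 by (simp add: Q_def u v pCons_one)
  have Q: "degX Q \<le> d" "deg Q \<le> d"
  proof -
    have "degX Q \<le> degX [:[:1 / v:]:] + degX M"
      using degX_mult_le[of "[:[:1 / v:]:]" M] by (simp add: Q_def)
    then show "degX Q \<le> d" using degM ab by (simp add: degX_const a_def)
    show "deg Q \<le> d" using degM ab degree_smult_le[of "[:1 / v:]" M] by (simp add: Q_def b_def)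
  qed
  \<comment> \<open>With \<open>D\<close> constant, dividing \<open>M\<close> by it reproduces
    \<open>f\<close> in all columns outside \<open>Yb\<close>.\<close>
  have "{y \<in> A. f y \<noteq> colp Q y} \<subseteq> Yb"
    by (auto simp: Yb_def DQ colp_mult) (simp add: colp_def u v v0)
  then have "card {y \<in> A. f y \<noteq> colp Q y} \<le> card Yb" by (rule card_mono[OF finb(2)])
  then have "card {y \<in> A. f y \<noteq> colp Q y} \<le> b1" using bad by linarith
  then have "2 * card {y \<in> A. f y \<noteq> colp Q y} + 2 * d \<le> n + 1" using b1_le nN by simp
  then show ?thesis using that Q by (simp add: n_def)
qed

section \<open>Ore's condition and the number of errors\<close>

lemma card_Er: "card Er = (\<Sum>x\<in>A. er_deg x)"
proof -
  have "Er = Sigma A (\<lambda>x. {y \<in> A. er x y})" by (auto simp: Er_def)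
  then show ?thesis using finA by (simp add: er_deg_def card_SigmaI)
qed

text \<open>Summing \<open>ore\<close> over the ordered errors produces twice the sum of the squared
  error degrees. Cauchy-Schwarz bounds that sum below by the square of \<open>card Er\<close>
  divided by \<open>card A\<close>, and one factor \<open>card Er\<close> cancels.\<close>

lemma double_card_Er_le:
  assumes ore: "\<And>x y. x \<in> A \<Longrightarrow> y \<in> A \<Longrightarrow> er x y \<Longrightarrow> er_deg x + er_deg y + 3 * d \<le> card A + 1"
    and n: "3 * d < card A"
  shows "2 * card Er + 3 * d * card A \<le> card A * (card A + 1)"
proof (cases "card Er = 0")
  case True
  have "3 * d * card A \<le> (card A + 1) * card A" using n by (intro mult_le_mono1) simp
  with True show ?thesis by (simp add: mult.commute)
next
  case False
  define s S2 n where "s = card Er" and "S2 = (\<Sum>x\<in>A. er_deg x * er_deg x)" and "n = card A"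
  have row: "(\<Sum>y\<in>{y \<in> A. er x y}. er_deg x) = er_deg x * er_deg x" for x
    by (simp add: er_deg_def)
  have "(\<Sum>x\<in>A. \<Sum>y\<in>{y \<in> A. er x y}. er_deg y) = (\<Sum>y\<in>A. \<Sum>x\<in>{x \<in> A. er x y}. er_deg y)"
    using finA by (intro sum.swap_restrict)
  also have "\<dots> = S2" unfolding S2_def
    by (intro sum.cong refl) (subst er_sym, rule row)
  finally have row': "(\<Sum>x\<in>A. \<Sum>y\<in>{y \<in> A. er x y}. er_deg y) = S2" .
  have const: "(\<Sum>x\<in>A. \<Sum>y\<in>{y \<in> A. er x y}. k) = s * k" for k
    by (simp add: s_def card_Er sum_distrib_right) (simp add: er_deg_def)
  have "2 * S2 + 3 * d * s = S2 + S2 + s * (3 * d)" by simp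
  also have "\<dots> = (\<Sum>x\<in>A. \<Sum>y\<in>{y \<in> A. er x y}. er_deg x + er_deg y + 3 * d)"
    by (simp only: sum.distrib row' const row S2_def[symmetric])
  also have "\<dots> \<le> (\<Sum>x\<in>A. \<Sum>y\<in>{y \<in> A. er x y}. n + 1)"
    unfolding n_def by (intro sum_mono ore) auto
  also have "\<dots> = s * (n + 1)" by (rule const)
  finally have 1: "2 * S2 + 3 * d * s \<le> s * (n + 1)" .
  \<comment> \<open>Cauchy-Schwarz, from the nonnegative sum of the squares of
    \<open>n * er_deg x - s\<close>.\<close>
  have "real s * real s \<le> real n * real S2"
  proof -
    have s: "real s = (\<Sum>x\<in>A. real (er_deg x))" by (simp add: s_def card_Er)
    have "0 \<le> (\<Sum>x\<in>A. (real n * real (er_deg x) - real s)\<^sup>2)" by (intro sum_nonneg) auto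
    also have "\<dots> = (\<Sum>x\<in>A. real n * real n * (real (er_deg x) * real (er_deg x)) - 2 * real n * real s * real (er_deg x) + real s * real s)"
      by (intro sum.cong refl) (simp add: power2_eq_square algebra_simps)
    also have "\<dots> = real n * real n * real S2 - 2 * real n * real s * (\<Sum>x\<in>A. real (er_deg x)) + real n * (real s * real s)"
      by (simp add: sum.distrib sum_subtractf S2_def n_def sum_distrib_left)
    also have "\<dots> = real n * (real n * real S2 - real s * real s)"
      by (simp add: s[symmetric] algebra_simps)
    finally show ?thesis using n by (simp add: n_def zero_le_mult_iff)
  qed
  then have "s * s \<le> n * S2" by (metis of_nat_le_iff of_nat_mult)
  then have "2 * (s * s) + 3 * d * n * s \<le> n * (2 * S2 + 3 * d * s)" by (simp add: algebra_simps)
  also have "\<dots> \<le> n * (s * (n + 1))" using 1 by (rule mult_le_mono2)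
  finally have "s * (2 * s + 3 * d * n) \<le> s * (n * (n + 1))" by (simp add: algebra_simps)
  then show ?thesis using False by (simp add: s_def n_def)
qed

text \<open>Decoding covers \<open>d >= 2\<close>. For \<open>d = 1\<close> each \<open>f z\<close>
  is \<open>\<mu> z * (t - z)\<close> and an error is a pair with different slopes, so every point
  forms an error with \<open>x\<close> or with \<open>y\<close>, against \<open>ore\<close>.\<close>

lemma no_er:
  assumes ore: "\<And>x y. x \<in> A \<Longrightarrow> y \<in> A \<Longrightarrow> er x y \<Longrightarrow> er_deg x + er_deg y + 3 * d \<le> card A + 1"
    and d: "d \<ge> 1" and n: "3 * d < card A" and x: "x \<in> A" and y: "y \<in> A"
  shows "\<not> er x y"
proof (cases "d \<ge> 2")
  case True
  from mostly_polynomial[OF True n double_card_Er_le[OF ore n]] obtain Q where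
    "degX Q \<le> d" "deg Q \<le> d" "2 * card {y \<in> A. f y \<noteq> colp Q y} + 2 * d \<le> card A + 1" .
  then show ?thesis using no_er_if_mostly_polynomial[OF ore d _ _ _ n x y] by blast
next
  case False
  then have d1: "d = 1" using d by simp
  have "\<exists>\<mu>. \<forall>t. poly (f z) t = \<mu> * (t - z)" if z: "z \<in> A" for z
  proof -
    have "[:- z, 1:] dvd f z" using root_f[OF z] by (simp add: poly_eq_0_iff_dvd)
    then obtain k where k: "f z = [:- z, 1:] * k" by (auto elim!: dvdE)
    have "deg k = 0"
    proof (cases "k = 0")
      case False
      then have "deg (f z) = 1 + deg k" unfolding k by (subst degree_mult_eq) auto
      then show ?thesis using deg_f[OF z] d1 by simp
    qed simp
    then obtain \<mu> where "k = [:\<mu>:]" by (metis degree_eq_zeroE)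
    then show ?thesis by (intro exI[of _ \<mu>]) (simp add: k algebra_simps)
  qed
  then obtain \<mu> where \<mu>: "\<And>z t. z \<in> A \<Longrightarrow> poly (f z) t = \<mu> z * (t - z)" by metis
  have er_\<mu>: "er u v \<longleftrightarrow> u \<noteq> v \<and> \<mu> u \<noteq> \<mu> v" if "u \<in> A" "v \<in> A" for u v
  proof -
    have "poly (f v) u + poly (f u) v = (\<mu> v - \<mu> u) * (u - v)"
      using that by (simp add: \<mu> algebra_simps)
    then show ?thesis by (auto simp: er_def)
  qed
  show ?thesis
  proof
    assume er: "er x y"
    have "A \<subseteq> {z \<in> A. er x z} \<union> {z \<in> A. er y z}" using er er_\<mu> x y by (auto simp: er_\<mu>)
    then have "card A \<le> er_deg x + er_deg y"
      unfolding er_deg_def using finA card_Un_le[of "{z \<in> A. er x z}" "{z \<in> A. er y z}"]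
        card_mono[of "{z \<in> A. er x z} \<union> {z \<in> A. er y z}" A] by simp
    then show False using ore[OF x y er] d1 by simp
  qed
qed

end

section \<open>Linear independence at generic points\<close>

text \<open>Polynomial functions with rational coefficients. The inductive form gives closure rules
  directly; monomials enter only to meet \<open>alg_indep_Q\<close>.\<close>

inductive polyfun :: "'i set \<Rightarrow> (('i \<Rightarrow> real) \<Rightarrow> real) \<Rightarrow> bool" for I where
  polyfun_rat: "polyfun I (\<lambda>_. of_rat c)"
| polyfun_var: "i \<in> I \<Longrightarrow> polyfun I (\<lambda>x. x i)"
| polyfun_add: "polyfun I F \<Longrightarrow> polyfun I G \<Longrightarrow> polyfun I (\<lambda>x. F x + G x)"
| polyfun_mult: "polyfun I F \<Longrightarrow> polyfun I G \<Longrightarrow> polyfun I (\<lambda>x. F x * G x)"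

lemma polyfun_int: "polyfun I (\<lambda>_. of_int c)"
  using polyfun_rat[of I "of_int c"] by simp

lemma polyfun_0: "polyfun I (\<lambda>_. 0)" and polyfun_1: "polyfun I (\<lambda>_. 1)"
  using polyfun_int[of I 0] polyfun_int[of I 1] by simp_all

lemma polyfun_diff:
  assumes "polyfun I F" "polyfun I G" shows "polyfun I (\<lambda>x. F x - G x)"
proof -
  have "polyfun I (\<lambda>x. F x + of_int (- 1) * G x)"
    by (intro polyfun_add polyfun_mult polyfun_int assms)
  then show ?thesis by simp
qed

lemma polyfun_sum: "(\<And>a. a \<in> S \<Longrightarrow> polyfun I (F a)) \<Longrightarrow> polyfun I (\<lambda>x. \<Sum>a\<in>S. F a x)"
  by (induction S rule: infinite_finite_induct) (auto intro: polyfun_0 polyfun_add)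

lemma polyfun_prod: "(\<And>a. a \<in> S \<Longrightarrow> polyfun I (F a)) \<Longrightarrow> polyfun I (\<lambda>x. \<Prod>a\<in>S. F a x)"
  by (induction S rule: infinite_finite_induct) (auto intro: polyfun_1 polyfun_mult)

lemma polyfun_monomial_sum:
  assumes "polyfun I F" "finite I"
  shows "\<exists>M c. finite M \<and> (\<forall>\<alpha>\<in>M. \<forall>i. i \<notin> I \<longrightarrow> \<alpha> i = 0) \<and>
    (\<forall>x. F x = (\<Sum>\<alpha>\<in>M. of_rat (c \<alpha>) * (\<Prod>i\<in>I. x i ^ \<alpha> i)))"
  using assms(1)
proof induction
  case (polyfun_rat r)
  show ?case by (intro exI[of _ "{\<lambda>_. 0}"] exI[of _ "\<lambda>_. r"]) auto
next
  case (polyfun_var i)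
  have "x i = (\<Prod>j\<in>I. x j ^ (if j = i then 1 else 0))" for x :: "'a \<Rightarrow> real"
    using polyfun_var assms(2) by (simp add: if_distrib[of "\<lambda>n. _ ^ n"] cong: if_cong)
  then show ?case using polyfun_var
    by (intro exI[of _ "{\<lambda>j. if j = i then 1 else 0}"] exI[of _ "\<lambda>_. 1"]) auto
next
  case (polyfun_add F G)
  then obtain M1 c1 M2 c2 where
    1: "finite M1" "\<forall>\<alpha>\<in>M1. \<forall>i. i \<notin> I \<longrightarrow> \<alpha> i = 0"
       "\<And>x. F x = (\<Sum>\<alpha>\<in>M1. of_rat (c1 \<alpha>) * (\<Prod>i\<in>I. x i ^ \<alpha> i))" and
    2: "finite M2" "\<forall>\<alpha>\<in>M2. \<forall>i. i \<notin> I \<longrightarrow> \<alpha> i = 0"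
       "\<And>x. G x = (\<Sum>\<alpha>\<in>M2. of_rat (c2 \<alpha>) * (\<Prod>i\<in>I. x i ^ \<alpha> i))" by auto
  define c where "c \<alpha> = (if \<alpha> \<in> M1 then c1 \<alpha> else 0) + (if \<alpha> \<in> M2 then c2 \<alpha> else 0)" for \<alpha>
  have "F x + G x = (\<Sum>\<alpha>\<in>M1 \<union> M2. of_rat (c \<alpha>) * (\<Prod>i\<in>I. x i ^ \<alpha> i))" for x
  proof -
    have "F x = (\<Sum>\<alpha>\<in>M1 \<union> M2. of_rat (if \<alpha> \<in> M1 then c1 \<alpha> else 0) * (\<Prod>i\<in>I. x i ^ \<alpha> i))"
      unfolding 1(3) using 1 2 by (intro sum.mono_neutral_cong_left) auto
    moreover have "G x = (\<Sum>\<alpha>\<in>M1 \<union> M2. of_rat (if \<alpha> \<in> M2 then c2 \<alpha> else 0) * (\<Prod>i\<in>I. x i ^ \<alpha> i))"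
      unfolding 2(3) using 1 2 by (intro sum.mono_neutral_cong_left) auto
    ultimately show ?thesis
      by (simp only: sum.distrib[symmetric] distrib_right[symmetric] of_rat_add[symmetric] c_def)
  qed
  with 1 2 show ?case by (intro exI[of _ "M1 \<union> M2"] exI[of _ c]) auto
next
  case (polyfun_mult F G)
  then obtain M1 c1 M2 c2 where
    1: "finite M1" "\<forall>\<alpha>\<in>M1. \<forall>i. i \<notin> I \<longrightarrow> \<alpha> i = 0"
       "\<And>x. F x = (\<Sum>\<alpha>\<in>M1. of_rat (c1 \<alpha>) * (\<Prod>i\<in>I. x i ^ \<alpha> i))" and
    2: "finite M2" "\<forall>\<alpha>\<in>M2. \<forall>i. i \<notin> I \<longrightarrow> \<alpha> i = 0"
       "\<And>x. G x = (\<Sum>\<alpha>\<in>M2. of_rat (c2 \<alpha>) * (\<Prod>i\<in>I. x i ^ \<alpha> i))" by auto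
  \<comment> \<open>Exponents add, and different pairs may have the same sum, so the coefficients
    are collected over the fibres of \<open>p\<close>.\<close>
  define p where "p = (\<lambda>(\<alpha>, \<beta>). \<lambda>i :: 'a. (\<alpha> i + \<beta> i :: nat))"
  define M where "M = p ` (M1 \<times> M2)"
  define c where "c \<gamma> = (\<Sum>z\<in>{z \<in> M1 \<times> M2. p z = \<gamma>}. c1 (fst z) * c2 (snd z))" for \<gamma>
  have "F x * G x = (\<Sum>\<gamma>\<in>M. of_rat (c \<gamma>) * (\<Prod>i\<in>I. x i ^ \<gamma> i))" for x
  proof -
    let ?h = "\<lambda>z. of_rat (c1 (fst z) * c2 (snd z)) * (\<Prod>i\<in>I. x i ^ p z i)"
    have "F x * G x = (\<Sum>z\<in>M1 \<times> M2. ?h z)"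
      by (simp add: 1(3) 2(3) sum_product sum.cartesian_product p_def split_def of_rat_mult
          power_add prod.distrib mult_ac)
    also have "\<dots> = (\<Sum>\<gamma>\<in>M. \<Sum>z\<in>{z \<in> M1 \<times> M2. p z = \<gamma>}. ?h z)"
      using 1 2 by (intro sum.group[symmetric]) (auto simp: M_def)
    also have "\<dots> = (\<Sum>\<gamma>\<in>M. of_rat (c \<gamma>) * (\<Prod>i\<in>I. x i ^ \<gamma> i))"
      by (intro sum.cong refl) (simp add: c_def of_rat_sum sum_distrib_right)
    finally show ?thesis .
  qed
  moreover have "finite M" "\<forall>\<alpha>\<in>M. \<forall>i. i \<notin> I \<longrightarrow> \<alpha> i = 0" using 1 2 by (auto simp: M_def p_def)
  ultimately show ?case by blast
qed

text \<open>Algebraic independence makes all coefficients of the monomial expansion zero, so the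
  function vanishes everywhere.\<close>

lemma polyfun_zero_at_alg_indep:
  assumes "alg_indep_Q I x" "finite I" "polyfun I F" "F x = 0"
  shows "F y = 0"
proof -
  obtain M c where M: "finite M" "\<forall>\<alpha>\<in>M. \<forall>i. i \<notin> I \<longrightarrow> \<alpha> i = 0"
    "\<And>x. F x = (\<Sum>\<alpha>\<in>M. of_rat (c \<alpha>) * (\<Prod>i\<in>I. x i ^ \<alpha> i))"
    using polyfun_monomial_sum[OF assms(3,2)] by blast
  have "(\<Sum>\<alpha>\<in>M. of_rat (c \<alpha>) * (\<Prod>i\<in>I. x i ^ \<alpha> i)) = 0" using assms(4) M(3) by simp
  with assms(1) M(1,2) have "\<forall>\<alpha>\<in>M. c \<alpha> = 0"
    unfolding alg_indep_Q_def by (elim allE[of _ M] allE[of _ c]) blast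
  then show ?thesis by (simp add: M(3))
qed

section \<open>Linear independence through Gram determinants\<close>

definition lin_indep :: "'b set \<Rightarrow> 'j set \<Rightarrow> ('b \<Rightarrow> 'j \<Rightarrow> real) \<Rightarrow> bool" where
  "lin_indep B J a \<longleftrightarrow> (\<forall>c. (\<forall>j\<in>J. (\<Sum>b\<in>B. c b * a b j) = 0) \<longrightarrow> (\<forall>b\<in>B. c b = 0))"

text \<open>A fixed order of \<open>B\<close>, because matrices are indexed by natural
  numbers.\<close>

definition enumeration :: "'b set \<Rightarrow> nat \<Rightarrow> 'b" where
  "enumeration B = (SOME e. bij_betw e {0..<card B} B)"

lemma bij_betw_enumeration: "finite B \<Longrightarrow> bij_betw (enumeration B) {0..<card B} B"
  unfolding enumeration_def using ex_bij_betw_nat_finite by (rule someI_ex)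

lemma enumeration_in: "finite B \<Longrightarrow> i < card B \<Longrightarrow> enumeration B i \<in> B"
  using bij_betw_enumeration[of B] by (auto simp: bij_betw_def)

definition gram_mat :: "'b set \<Rightarrow> ('b \<Rightarrow> 'b \<Rightarrow> real) \<Rightarrow> real mat" where
  "gram_mat B g = mat (card B) (card B) (\<lambda>(i, j). g (enumeration B i) (enumeration B j))"

definition gram_det :: "'b set \<Rightarrow> ('b \<Rightarrow> 'b \<Rightarrow> real) \<Rightarrow> real" where
  "gram_det B g = det (gram_mat B g)"

text \<open>Exhibits the determinant as a polynomial expression in the entries, from which
  congruence, \<open>polyfun\<close> and continuity follow termwise.\<close>

lemma gram_det_leibniz:
  "gram_det B g = (\<Sum>p | p permutes {0..<card B}. of_int (sign p) *
     (\<Prod>i = 0..<card B. g (enumeration B i) (enumeration B (p i))))"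
  unfolding gram_det_def gram_mat_def det_def
  by (auto simp: permutes_nat_less intro!: sum.cong prod.cong)

lemma gram_det_cong:
  assumes "finite B" "\<And>b b'. b \<in> B \<Longrightarrow> b' \<in> B \<Longrightarrow> g b b' = h b b'"
  shows "gram_det B g = gram_det B h"
  unfolding gram_det_leibniz using enumeration_in[OF assms(1)] using assms(2)
    by (auto simp: permutes_nat_less intro!: sum.cong prod.cong)

lemma polyfun_gram_det:
  assumes "finite B" "\<And>b b'. b \<in> B \<Longrightarrow> b' \<in> B \<Longrightarrow> polyfun I (\<lambda>x. g x b b')"
  shows "polyfun I (\<lambda>x. gram_det B (g x))"
  unfolding gram_det_leibniz using enumeration_in[OF assms(1)]
    by (auto simp: permutes_nat_less intro!: polyfun_sum polyfun_mult polyfun_prod polyfun_int assms(2))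

lemma tendsto_gram_det:
  assumes "finite B" "\<And>b b'. b \<in> B \<Longrightarrow> b' \<in> B \<Longrightarrow> ((\<lambda>t. g t b b') \<longlongrightarrow> h b b') F"
  shows "((\<lambda>t. gram_det B (g t)) \<longlongrightarrow> gram_det B h) F"
  unfolding gram_det_leibniz using enumeration_in[OF assms(1)]
    by (auto simp: permutes_nat_less intro!: tendsto_sum tendsto_mult tendsto_const tendsto_prod assms(2))

text \<open>If the Gram matrix kills \<open>c\<close>, its quadratic form vanishes at
  \<open>c\<close>. That value is the squared length of the combination of the rows with
  coefficients \<open>c\<close>, so over the reals the combination is zero.\<close>

lemma gram_det_nonzero_iff:
  assumes B: "finite B" and J: "finite J"
  shows "gram_det B (\<lambda>b b'. \<Sum>j\<in>J. a b j * a b' j) \<noteq> 0 \<longleftrightarrow> lin_indep B J a"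
proof -
  define k where "k = card B"
  define g where "g b b' = (\<Sum>j\<in>J. a b j * a b' j)" for b b'
  define e where "e = enumeration B"
  have e: "bij_betw e {0..<k} B" using bij_betw_enumeration[OF B] by (simp add: e_def k_def)
  define G where "G = mat k k (\<lambda>(i, j). g (e i) (e j))"
  have GD: "gram_det B g = det G" by (simp add: gram_det_def gram_mat_def G_def e_def k_def)
  have det: "gram_det B g = 0 \<longleftrightarrow> (\<exists>v\<in>carrier_vec k. v \<noteq> 0\<^sub>v k \<and> G *\<^sub>v v = 0\<^sub>v k)"
    unfolding GD by (subst det_0_iff_vec_prod_zero_field[of _ k]) (auto simp: G_def)
  have sum_e: "(\<Sum>i = 0..<k. F (e i)) = (\<Sum>b\<in>B. F b)" for F :: "'a \<Rightarrow> real"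
    using e by (rule sum.reindex_bij_betw)
  have eB: "e i \<in> B" if "i < k" for i using e that by (auto simp: bij_betw_def)
  have Gv: "(G *\<^sub>v vec k (\<lambda>i. c (e i))) $ i = (\<Sum>j\<in>J. a (e i) j * (\<Sum>b\<in>B. c b * a b j))"
    if "i < k" for i c
  proof -
    have "(G *\<^sub>v vec k (\<lambda>i. c (e i))) $ i = (\<Sum>l = 0..<k. g (e i) (e l) * c (e l))"
      using that by (simp add: G_def scalar_prod_def)
    also have "\<dots> = (\<Sum>b\<in>B. g (e i) b * c b)" by (rule sum_e)
    also have "\<dots> = (\<Sum>b\<in>B. \<Sum>j\<in>J. a (e i) j * (c b * a b j))"
      by (simp add: g_def sum_distrib_left sum_distrib_right mult_ac)
    also have "\<dots> = (\<Sum>j\<in>J. \<Sum>b\<in>B. a (e i) j * (c b * a b j))" by (rule sum.swap)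
    finally show ?thesis by (simp add: sum_distrib_left)
  qed
  show ?thesis
    unfolding g_def[symmetric]
  proof
    assume nz: "gram_det B g \<noteq> 0"
    show "lin_indep B J a"
      unfolding lin_indep_def
    proof (intro allI impI ballI, rule ccontr)
      fix c b assume c: "\<forall>j\<in>J. (\<Sum>b\<in>B. c b * a b j) = 0" and b: "b \<in> B" "c b \<noteq> 0"
      obtain i where i: "i < k" "e i = b" using e b by (auto simp: bij_betw_def)
      define v where "v = vec k (\<lambda>i. c (e i))"
      have "v \<noteq> 0\<^sub>v k"
      proof
        assume "v = 0\<^sub>v k"
        then have "v $ i = 0\<^sub>v k $ i" by simp
        then show False using i b by (simp add: v_def)
      qed
      moreover have "G *\<^sub>v v = 0\<^sub>v k"
        by (rule eq_vecI) (use c in \<open>auto simp: v_def Gv simp del: index_mult_mat_vec\<close>, simp add: G_def)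
      ultimately show False using nz det by (auto simp: v_def)
    qed
  next
    assume ind: "lin_indep B J a"
    show "gram_det B g \<noteq> 0"
    proof
      assume "gram_det B g = 0"
      then obtain v where v: "v \<in> carrier_vec k" "v \<noteq> 0\<^sub>v k" "G *\<^sub>v v = 0\<^sub>v k" using det by blast
      define c where "c b = v $ (inv_into {0..<k} e b)" for b
      have ce: "c (e i) = v $ i" if "i < k" for i
        using e that by (simp add: c_def bij_betw_def inv_into_f_f)
      have vc: "v = vec k (\<lambda>i. c (e i))" using v by (intro eq_vecI) (auto simp: ce)
      have 0: "(\<Sum>j\<in>J. a b j * (\<Sum>b\<in>B. c b * a b j)) = 0" if b: "b \<in> B" for b
      proof -
        obtain i where i: "i < k" "e i = b" using e b by (auto simp: bij_betw_def)
        show ?thesis using Gv[OF i(1), of c] v(3) i by (simp flip: vc)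
      qed
      have "(\<Sum>j\<in>J. (\<Sum>b\<in>B. c b * a b j)\<^sup>2) = (\<Sum>j\<in>J. \<Sum>b\<in>B. c b * (a b j * (\<Sum>b\<in>B. c b * a b j)))"
        by (simp add: power2_eq_square sum_distrib_right mult.assoc)
      also have "\<dots> = (\<Sum>b\<in>B. \<Sum>j\<in>J. c b * (a b j * (\<Sum>b\<in>B. c b * a b j)))" by (rule sum.swap)
      also have "\<dots> = 0" by (simp add: 0 flip: sum_distrib_left)
      finally have "\<forall>j\<in>J. (\<Sum>b\<in>B. c b * a b j) = 0" using J by (simp add: sum_nonneg_eq_0_iff)
      then have "\<forall>b\<in>B. c b = 0" using ind by (simp add: lin_indep_def)
      then have "v = 0\<^sub>v k" unfolding vc using eB by (intro eq_vecI) auto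
      with v show False by simp
    qed
  qed
qed

text \<open>The Gram determinant is a rational polynomial in the point, so being nonzero at
  \<open>y\<close> excludes a zero at the algebraically independent \<open>x\<close>.\<close>

lemma lin_indep_transfer:
  assumes x: "alg_indep_Q I x" and fin: "finite I" "finite B" "finite J"
    and a: "\<And>b j. b \<in> B \<Longrightarrow> j \<in> J \<Longrightarrow> polyfun I (\<lambda>x. a x b j)"
    and ind: "lin_indep B J (a y)"
  shows "lin_indep B J (a x)"
proof -
  let ?F = "\<lambda>x. gram_det B (\<lambda>b b'. \<Sum>j\<in>J. a x b j * a x b' j)"
  have "polyfun I ?F"
    using fin by (intro polyfun_gram_det polyfun_sum polyfun_mult a)
  moreover have "?F y \<noteq> 0" using gram_det_nonzero_iff[OF fin(2,3)] ind by blast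
  ultimately have "?F x \<noteq> 0" using polyfun_zero_at_alg_indep[OF x fin(1), of ?F y] by blast
  then show ?thesis using gram_det_nonzero_iff[OF fin(2,3)] by blast
qed

text \<open>A dependency of the joint family would split into orthogonal vectors \<open>u\<close>
  and \<open>v\<close> with \<open>u + v = 0\<close>, both of which must be zero.\<close>

lemma lin_indep_orthogonal_card:
  assumes fin: "finite B" "finite T" "finite I"
    and ind: "lin_indep B I a" "lin_indep T I b"
    and orth: "\<And>s t. s \<in> B \<Longrightarrow> t \<in> T \<Longrightarrow> (\<Sum>k\<in>I. a s k * b t k) = 0"
  shows "card B + card T \<le> card I"
proof (rule ccontr)
  assume "\<not> ?thesis"
  then have "card I < card (B <+> T)" using fin by (simp add: card_Plus)
  then obtain c where c: "\<exists>z\<in>B <+> T. c z \<noteq> 0"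
    "\<forall>k\<in>I. (\<Sum>z\<in>B <+> T. case_sum (\<lambda>s. a s k) (\<lambda>t. b t k) z * c z) = 0"
    using underdetermined_system[of I "B <+> T" "\<lambda>k. case_sum (\<lambda>s. a s k) (\<lambda>t. b t k)"] fin by auto
  define u where "u k = (\<Sum>s\<in>B. c (Inl s) * a s k)" for k
  define v where "v k = (\<Sum>t\<in>T. c (Inr t) * b t k)" for k
  have uv: "u k + v k = 0" if "k \<in> I" for k
    using bspec[OF c(2) that] fin by (simp add: sum.Plus u_def v_def mult.commute)
  have "(\<Sum>k\<in>I. u k * v k) = (\<Sum>k\<in>I. \<Sum>s\<in>B. \<Sum>t\<in>T. c (Inl s) * c (Inr t) * (a s k * b t k))"
    by (simp add: u_def v_def sum_product mult_ac)
  also have "\<dots> = (\<Sum>s\<in>B. \<Sum>k\<in>I. \<Sum>t\<in>T. c (Inl s) * c (Inr t) * (a s k * b t k))" by (rule sum.swap)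
  also have "\<dots> = (\<Sum>s\<in>B. \<Sum>t\<in>T. \<Sum>k\<in>I. c (Inl s) * c (Inr t) * (a s k * b t k))"
    by (intro sum.cong refl sum.swap)
  also have "\<dots> = (\<Sum>s\<in>B. \<Sum>t\<in>T. c (Inl s) * c (Inr t) * (\<Sum>k\<in>I. a s k * b t k))"
    by (simp add: sum_distrib_left)
  also have "\<dots> = 0" by (simp add: orth)
  finally have "(\<Sum>k\<in>I. u k * v k) = 0" .
  moreover have "(\<Sum>k\<in>I. u k * v k) = - (\<Sum>k\<in>I. (u k)\<^sup>2)"
    unfolding sum_negf[symmetric]
  proof (intro sum.cong refl)
    fix k assume "k \<in> I"
    then have "v k = - u k" using uv[of k] by linarith
    then show "u k * v k = - (u k)\<^sup>2" by (simp add: power2_eq_square)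
  qed
  ultimately have "\<forall>k\<in>I. u k = 0" using fin by (simp add: sum_nonneg_eq_0_iff)
  moreover from this uv have "\<forall>k\<in>I. v k = 0" by force
  ultimately have "\<forall>s\<in>B. c (Inl s) = 0" "\<forall>t\<in>T. c (Inr t) = 0"
    using ind unfolding lin_indep_def u_def v_def
    by (auto dest: spec[of _ "\<lambda>s. c (Inl s)"] spec[of _ "\<lambda>t. c (Inr t)"])
  with c(1) show False by auto
qed

text \<open>The row of \<open>e\<close> lies in the span of the rows of \<open>B\<close>, hence is
  orthogonal to whatever they are orthogonal to.\<close>

lemma lin_dep_insert_kernel:
  assumes fin: "finite B" and e: "e \<notin> B"
    and ind: "lin_indep B I a" and dep: "\<not> lin_indep (insert e B) I a"
    and ker: "\<And>b. b \<in> B \<Longrightarrow> (\<Sum>k\<in>I. a b k * m k) = 0"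
  shows "(\<Sum>k\<in>I. a e k * m k) = 0"
proof -
  obtain c where c: "\<And>j. j \<in> I \<Longrightarrow> c e * a e j + (\<Sum>b\<in>B. c b * a b j) = 0"
    "\<exists>b\<in>insert e B. c b \<noteq> 0"
    using dep fin e unfolding lin_indep_def by auto
  have "c e \<noteq> 0"
  proof
    assume "c e = 0"
    with c ind show False unfolding lin_indep_def by (auto dest: spec[of _ c])
  qed
  have "c e * (\<Sum>k\<in>I. a e k * m k) = (\<Sum>k\<in>I. - (\<Sum>b\<in>B. c b * a b k) * m k)"
    unfolding sum_distrib_left
  proof (intro sum.cong refl)
    fix k assume "k \<in> I"
    then have "c e * a e k = - (\<Sum>b\<in>B. c b * a b k)" using c(1)[of k] by linarith
    then show "c e * (a e k * m k) = - (\<Sum>b\<in>B. c b * a b k) * m k"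
      by (simp only: mult.assoc[symmetric])
  qed
  also have "\<dots> = - (\<Sum>k\<in>I. \<Sum>b\<in>B. c b * (a b k * m k))"
    by (simp add: sum_distrib_right sum_negf mult.assoc)
  also have "(\<Sum>k\<in>I. \<Sum>b\<in>B. c b * (a b k * m k)) = (\<Sum>b\<in>B. \<Sum>k\<in>I. c b * (a b k * m k))" by (rule sum.swap)
  also have "\<dots> = 0" by (simp add: ker flip: sum_distrib_left)
  finally show ?thesis using \<open>c e \<noteq> 0\<close> by simp
qed

section \<open>The rigidity matrix\<close>

text \<open>Half the derivative of the squared distance of \<open>u\<close> and \<open>v\<close> in
  the direction \<open>m\<close>.\<close>

definition strain :: "nat \<Rightarrow> ('a \<times> nat \<Rightarrow> real) \<Rightarrow> ('a \<times> nat \<Rightarrow> real) \<Rightarrow> 'a \<Rightarrow> 'a \<Rightarrow> real" where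
  "strain d x m u v = (\<Sum>i<d. (x (u, i) - x (v, i)) * (m (u, i) - m (v, i)))"

definition rigidity_row :: "('a \<times> nat \<Rightarrow> real) \<Rightarrow> 'a \<times> 'a \<Rightarrow> 'a \<times> nat \<Rightarrow> real" where
  "rigidity_row x e k = (of_bool (fst k = fst e) - of_bool (fst k = snd e)) *
     (x (fst e, snd k) - x (snd e, snd k))"

lemma sum_rigidity_row:
  assumes "finite V" "u \<in> V" "v \<in> V"
  shows "(\<Sum>k\<in>V \<times> {..<d}. rigidity_row x (u, v) k * m k) = strain d x m u v"
proof -
  have "(\<Sum>k\<in>V \<times> {..<d}. rigidity_row x (u, v) k * m k)
        = (\<Sum>w\<in>V. \<Sum>i<d. rigidity_row x (u, v) (w, i) * m (w, i))"
    by (simp add: sum.cartesian_product split_def)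
  also have "\<dots> = (\<Sum>i<d. \<Sum>w\<in>V. rigidity_row x (u, v) (w, i) * m (w, i))" by (rule sum.swap)
  also have "\<dots> = (\<Sum>i<d. (\<Sum>w\<in>V. if w = u then (x (u, i) - x (v, i)) * m (w, i) else 0)
                       - (\<Sum>w\<in>V. if w = v then (x (u, i) - x (v, i)) * m (w, i) else 0))"
    unfolding sum_subtractf[symmetric]
    by (intro sum.cong refl) (auto simp: rigidity_row_def algebra_simps)
  also have "\<dots> = strain d x m u v"
    using assms by (simp add: strain_def right_diff_distrib)
  finally show ?thesis .
qed

definition rigidity_gram :: "'a set \<Rightarrow> nat \<Rightarrow> ('a \<times> nat \<Rightarrow> real) \<Rightarrow> 'a \<times> 'a \<Rightarrow> 'a \<times> 'a \<Rightarrow> real" where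
  "rigidity_gram V d x e e' = (\<Sum>k\<in>V \<times> {..<d}. rigidity_row x e k * rigidity_row x e' k)"

text \<open>\<open>sqdist\<close> in the uncurried form of placements, in which the coordinates are
  the variables of \<open>polyfun\<close>.\<close>

definition sqd :: "nat \<Rightarrow> ('a \<times> nat \<Rightarrow> real) \<Rightarrow> 'a \<Rightarrow> 'a \<Rightarrow> real" where
  "sqd d x u v = (\<Sum>i<d. (x (u, i) - x (v, i))\<^sup>2)"

text \<open>Polarization: the inner product of two edge vectors is a combination of four squared
  distances, so the Gram matrix sees a placement only through its distances. The first factor counts
  common endpoints with sign.\<close>

lemma rigidity_gram_sqd:
  assumes "finite V" "u \<in> V" "v \<in> V"
  shows "rigidity_gram V d x (u, v) (u', v') =
    (of_bool (u = u') - of_bool (u = v') - of_bool (v = u') + of_bool (v = v')) *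
    (sqd d x u v' + sqd d x v u' - sqd d x u u' - sqd d x v v') / 2"
proof -
  define \<kappa> :: real where "\<kappa> = of_bool (u = u') - of_bool (u = v') - of_bool (v = u') + of_bool (v = v')"
  have "rigidity_gram V d x (u, v) (u', v') = strain d x (rigidity_row x (u', v')) u v"
    unfolding rigidity_gram_def using assms by (rule sum_rigidity_row)
  also have "\<dots> = (\<Sum>i<d. \<kappa> * ((x (u, i) - x (v', i))\<^sup>2 + (x (v, i) - x (u', i))\<^sup>2
                 - (x (u, i) - x (u', i))\<^sup>2 - (x (v, i) - x (v', i))\<^sup>2) / 2)"
    unfolding strain_def
    by (intro sum.cong refl) (simp add: rigidity_row_def \<kappa>_def power2_eq_square field_simps)
  also have "\<dots> = \<kappa> * (sqd d x u v' + sqd d x v u' - sqd d x u u' - sqd d x v v') / 2"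
    by (simp add: sqd_def sum.distrib sum_subtractf flip: sum_distrib_left sum_divide_distrib)
  finally show ?thesis by (simp add: \<kappa>_def)
qed

text \<open>Carries a nonzero Gram determinant from the generic placement to congruent ones, which
  need not be generic.\<close>

lemma gram_det_congruent:
  assumes V: "finite V" and B: "B \<subseteq> V \<times> V"
    and eq: "\<And>u v. u \<in> V \<Longrightarrow> v \<in> V \<Longrightarrow> sqd d x u v = sqd d y u v"
  shows "gram_det B (rigidity_gram V d x) = gram_det B (rigidity_gram V d y)"
proof (rule gram_det_cong)
  show "finite B" using V B by (meson finite_SigmaI finite_subset)
  fix b b' assume "b \<in> B" "b' \<in> B"
  then obtain u v u' v' where "b = (u, v)" "b' = (u', v')" "u \<in> V" "v \<in> V" "u' \<in> V" "v' \<in> V"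
    using B by blast
  then show "rigidity_gram V d x b b' = rigidity_gram V d y b b'"
    using V eq by (simp add: rigidity_gram_sqd)
qed

lemma polyfun_rigidity_row:
  assumes "e \<in> V \<times> V" "k \<in> V \<times> {..<d}"
  shows "polyfun (V \<times> {..<d}) (\<lambda>x. rigidity_row x e k)"
proof -
  have "polyfun (V \<times> {..<d}) (\<lambda>x. of_int (of_bool (fst k = fst e) - of_bool (fst k = snd e)) *
     (x (fst e, snd k) - x (snd e, snd k)))"
    using assms by (intro polyfun_mult polyfun_int polyfun_diff polyfun_var) (auto simp: mem_Times_iff)
  then show ?thesis by (simp add: rigidity_row_def)
qed

lemma polyfun_rigidity_gram_det:
  assumes "finite V" "B \<subseteq> V \<times> V"
  shows "polyfun (V \<times> {..<d}) (\<lambda>x. gram_det B (rigidity_gram V d x))"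
  unfolding rigidity_gram_def
  using assms by (intro polyfun_gram_det polyfun_sum polyfun_mult polyfun_rigidity_row)
    (auto intro: finite_subset[of B "V \<times> V"])

lemma rigidity_gram_det_nonzero_iff:
  assumes "finite V" "B \<subseteq> V \<times> V"
  shows "gram_det B (rigidity_gram V d x) \<noteq> 0 \<longleftrightarrow> lin_indep B (V \<times> {..<d}) (rigidity_row x)"
proof -
  have "finite B" using assms by (meson finite_SigmaI finite_subset)
  then show ?thesis
    using gram_det_nonzero_iff[of B "V \<times> {..<d}" "rigidity_row x"] assms(1)
    by (simp add: rigidity_gram_def[abs_def])
qed

section \<open>Trivial infinitesimal motions\<close>

text \<open>In homogeneous coordinates the translations are the infinitesimal rotations involving the
  coordinate \<open>0\<close>, so all trivial motions are indexed by pairs \<open>l < k \<le> d\<close>.\<close>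

definition hom_coord :: "('a \<times> nat \<Rightarrow> real) \<Rightarrow> 'a \<Rightarrow> nat \<Rightarrow> real" where
  "hom_coord x w j = (if j = 0 then 1 else x (w, j - 1))"

text \<open>For \<open>t = (l, k)\<close>, the skew-symmetric matrix with entries \<open>1\<close>
  at \<open>(k, l)\<close> and \<open>-1\<close> at \<open>(l, k)\<close> is applied to the
  homogeneous coordinates, and coordinate \<open>0\<close> is dropped.\<close>

definition trivial_motion :: "('a \<times> nat \<Rightarrow> real) \<Rightarrow> nat \<times> nat \<Rightarrow> 'a \<times> nat \<Rightarrow> real" where
  "trivial_motion x t k = of_bool (Suc (snd k) = snd t) * hom_coord x (fst k) (fst t)
     - of_bool (Suc (snd k) = fst t) * hom_coord x (fst k) (snd t)"

definition pair_index :: "nat \<Rightarrow> (nat \<times> nat) set" where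
  "pair_index d = {(l, k). l < k \<and> k \<le> d}"

lemma finite_pair_index: "finite (pair_index d)"
  by (rule finite_subset[of _ "{..d} \<times> {..d}"]) (auto simp: pair_index_def)

text \<open>A skew-symmetric form vanishes at a pair of equal vectors, here at the difference
  \<open>H\<close> of homogeneous coordinates. Since \<open>H 0 = 0\<close>, dropping coordinate
  \<open>0\<close> does no harm.\<close>

lemma strain_trivial_motion:
  assumes "t \<in> pair_index d"
  shows "strain d x (trivial_motion x t) u v = 0"
proof -
  obtain l k where t: "t = (l, k)" "l < k" "k \<le> d" using assms by (auto simp: pair_index_def)
  define H where "H j = hom_coord x u j - hom_coord x v j" for j
  have H: "H (Suc i) = x (u, i) - x (v, i)" "H 0 = 0" for i by (simp_all add: H_def hom_coord_def)
  have "strain d x (trivial_motion x t) u v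
        = (\<Sum>i<d. (if i = k - 1 then H k * H l else 0) - (if Suc i = l then H l * H k else 0))"
    unfolding strain_def
  proof (intro sum.cong refl)
    fix i
    have "trivial_motion x t (u, i) - trivial_motion x t (v, i)
          = of_bool (Suc i = k) * H l - of_bool (Suc i = l) * H k"
      by (simp add: trivial_motion_def t H_def algebra_simps)
    then show "(x (u, i) - x (v, i)) * (trivial_motion x t (u, i) - trivial_motion x t (v, i))
          = (if i = k - 1 then H k * H l else 0) - (if Suc i = l then H l * H k else 0)"
      using t H(1)[of i] by auto
  qed
  also have "\<dots> = H k * H l - (\<Sum>i<d. if Suc i = l then H l * H k else 0)"
    using t by (simp add: sum_subtractf)
  also have "(\<Sum>i<d. if Suc i = l then H l * H k else 0) = H l * H k"
  proof (cases l)
    case 0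
    then show ?thesis using H by simp
  next
    case (Suc l')
    then have "l' < d" using t by simp
    then show ?thesis using Suc by simp
  qed
  finally show ?thesis by simp
qed

text \<open>In coordinate \<open>k - 1\<close> a dependency is a linear relation among the
  homogeneous coordinates; its coefficients \<open>b\<close> form row \<open>k\<close> of the
  skew-symmetric matrix built from \<open>c\<close>.\<close>

lemma lin_indep_trivial_motion:
  assumes "lin_indep {..d} V (\<lambda>s w. hom_coord x w s)"
  shows "lin_indep (pair_index d) (V \<times> {..<d}) (trivial_motion x)"
  unfolding lin_indep_def
proof (intro allI impI ballI)
  fix c t
  assume c: "\<forall>j\<in>V \<times> {..<d}. (\<Sum>b\<in>pair_index d. c b * trivial_motion x b j) = 0"
    and t: "t \<in> pair_index d"
  obtain l k where lk: "t = (l, k)" "l < k" "k \<le> d" using t by (auto simp: pair_index_def)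
  define b where "b s = (if s < k then c (s, k) else 0) - (if k < s then c (k, s) else 0)" for s
  have "(\<Sum>s\<le>d. b s * hom_coord x w s) = 0" if w: "w \<in> V" for w
  proof -
    let ?H = "hom_coord x w"
    have "0 = (\<Sum>z\<in>pair_index d. c z * trivial_motion x z (w, k - 1))" using c w lk by auto
    also have "\<dots> = (\<Sum>z\<in>{..d} \<times> {..d}. if fst z < snd z then c z * trivial_motion x z (w, k - 1) else 0)"
      by (rule sum.mono_neutral_cong_left) (auto simp: pair_index_def)
    also have "\<dots> = (\<Sum>s\<le>d. \<Sum>r\<le>d. if s < r then c (s, r) * trivial_motion x (s, r) (w, k - 1) else 0)"
      by (simp add: sum.cartesian_product split_def cong: if_cong)
    also have "\<dots> = (\<Sum>s\<le>d. \<Sum>r\<le>d. (if r = k then (if s < k then c (s, k) * ?H s else 0) else 0)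
                                  - (if s = k then (if k < r then c (k, r) * ?H r else 0) else 0))"
      using lk by (intro sum.cong refl) (auto simp: trivial_motion_def)
    also have "\<dots> = (\<Sum>s\<le>d. \<Sum>r\<le>d. if r = k then (if s < k then c (s, k) * ?H s else 0) else 0)
                   - (\<Sum>s\<le>d. \<Sum>r\<le>d. if s = k then (if k < r then c (k, r) * ?H r else 0) else 0)"
      by (simp only: sum_subtractf)
    also have "(\<Sum>s\<le>d. \<Sum>r\<le>d. if s = k then (if k < r then c (k, r) * ?H r else 0) else 0)
             = (\<Sum>r\<le>d. \<Sum>s\<le>d. if s = k then (if k < r then c (k, r) * ?H r else 0) else 0)"
      by (rule sum.swap)
    also have "(\<Sum>s\<le>d. \<Sum>r\<le>d. if r = k then (if s < k then c (s, k) * ?H s else 0) else 0)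
                   - (\<Sum>r\<le>d. \<Sum>s\<le>d. if s = k then (if k < r then c (k, r) * ?H r else 0) else 0)
             = (\<Sum>s\<le>d. if s < k then c (s, k) * ?H s else 0) - (\<Sum>r\<le>d. if k < r then c (k, r) * ?H r else 0)"
      using lk by (simp add: sum.delta)
    also have "\<dots> = (\<Sum>s\<le>d. b s * ?H s)"
      unfolding sum_subtractf[symmetric] by (intro sum.cong refl) (simp add: b_def)
    finally show ?thesis by simp
  qed
  then have "\<forall>s\<in>{..d}. b s = 0" using assms unfolding lin_indep_def by blast
  then have "b l = 0" using lk by auto
  then show "c t = 0" using lk by (simp add: b_def)
qed

section \<open>Ore's condition implies rigidity\<close>

definition moment_placement :: "('a \<Rightarrow> real) \<Rightarrow> 'a \<times> nat \<Rightarrow> real" where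
  "moment_placement \<tau> k = \<tau> (fst k) ^ Suc (snd k)"

text \<open>The points of the moment curve enter \<open>motion_poly\<close> through \<open>(x\<^sub>v - x(t)) \<bullet> m\<^sub>v\<close>, a polynomial
  in the curve parameter \<open>t\<close>.\<close>

definition motion_poly :: "nat \<Rightarrow> ('a \<Rightarrow> real) \<Rightarrow> ('a \<times> nat \<Rightarrow> real) \<Rightarrow> 'a \<Rightarrow> real poly" where
  "motion_poly d \<tau> m v =
     [:\<Sum>i<d. \<tau> v ^ Suc i * m (v, i):] - (\<Sum>i<d. monom (m (v, i)) (Suc i))"

lemma poly_motion_poly:
  "poly (motion_poly d \<tau> m v) s = (\<Sum>i<d. (\<tau> v ^ Suc i - s ^ Suc i) * m (v, i))"
  by (simp add: motion_poly_def poly_sum poly_monom algebra_simps sum_subtractf del: power_Suc)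

lemma degree_motion_poly: "deg (motion_poly d \<tau> m v) \<le> d"
  unfolding motion_poly_def
  by (intro degree_diff_le degree_sum_le) (auto intro: order_trans[OF degree_monom_le])

lemma coeff_motion_poly: "i < d \<Longrightarrow> coeff (motion_poly d \<tau> m v) (Suc i) = - m (v, i)"
  by (simp add: motion_poly_def coeff_sum)

lemma strain_moment_placement:
  "strain d (moment_placement \<tau>) m u v
     = poly (motion_poly d \<tau> m u) (\<tau> v) + poly (motion_poly d \<tau> m v) (\<tau> u)"
  unfolding strain_def poly_motion_poly sum.distrib[symmetric]
  by (intro sum.cong refl) (simp add: moment_placement_def algebra_simps)

text \<open>The \<open>3\<close> on the right avoids truncated subtraction. A non-adjacent pair
  forces \<open>3 * d < card V\<close>; complete graphs are treated apart.\<close>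

locale ore_graph =
  fixes V :: "'a set" and E :: "'a \<Rightarrow> 'a \<Rightarrow> bool" and d :: nat
  assumes graph: "simple_graph V E" and d: "d \<ge> 1" and n: "3 * d < card V"
    and ore: "\<And>u v. u \<in> V \<Longrightarrow> v \<in> V \<Longrightarrow> u \<noteq> v \<Longrightarrow> \<not> E u v \<Longrightarrow>
      card V + 3 * d \<le> degree V E u + degree V E v + 3"
begin

lemma finV: "finite V" using graph by (simp add: simple_graph_def)

text \<open>No vertex forms an error with itself or a neighbour, so its error degree is at most
  \<open>card V - 1\<close> minus its degree, and Ore's condition becomes the hypothesis of
  \<open>no_er\<close>.\<close>

lemma moment_placement_rigid:
  assumes \<tau>: "inj_on \<tau> V"
    and m: "\<And>u v. E u v \<Longrightarrow> strain d (moment_placement \<tau>) m u v = 0"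
    and uv: "u \<in> V" "v \<in> V"
  shows "strain d (moment_placement \<tau>) m u v = 0"
proof -
  define f where "f t = motion_poly d \<tau> m (inv_into V \<tau> t)" for t
  have f: "f (\<tau> w) = motion_poly d \<tau> m w" if "w \<in> V" for w
    using that \<tau> by (simp add: f_def)
  interpret curve_motion "\<tau> ` V" f d
  proof
    show "finite (\<tau> ` V)" using finV by simp
    show "deg (f x) \<le> d" for x by (simp add: f_def degree_motion_poly)
    show "poly (f x) x = 0" if "x \<in> \<tau> ` V" for x using that f by (auto simp: poly_motion_poly)
  qed
  have er: "er (\<tau> a) (\<tau> b) \<longleftrightarrow> strain d (moment_placement \<tau>) m a b \<noteq> 0" if "a \<in> V" "b \<in> V" for a b
    using that by (simp add: er_def strain_moment_placement f add.commute)
  have deg_le: "er_deg (\<tau> a) + degree V E a + 1 \<le> card V" if a: "a \<in> V" for a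
  proof -
    have "{z \<in> \<tau> ` V. er (\<tau> a) z} = \<tau> ` {b \<in> V. er (\<tau> a) (\<tau> b)}" by auto
    then have "er_deg (\<tau> a) = card {b \<in> V. er (\<tau> a) (\<tau> b)}"
      unfolding er_deg_def using \<tau> by (simp add: card_image inj_on_def)
    moreover have "{b \<in> V. er (\<tau> a) (\<tau> b)} \<inter> {b \<in> V. E a b} = {}"
      using er[OF a] m by auto
    moreover have "a \<notin> {b \<in> V. er (\<tau> a) (\<tau> b)} \<union> {b \<in> V. E a b}"
      using er_irrefl graph by (auto simp: simple_graph_def)
    moreover have "card (insert a ({b \<in> V. er (\<tau> a) (\<tau> b)} \<union> {b \<in> V. E a b})) \<le> card V"
      using finV a by (intro card_mono) auto
    ultimately show ?thesis using finV by (simp add: degree_def card_Un_disjoint)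
  qed
  have "er_deg x + er_deg y + 3 * d \<le> card (\<tau> ` V) + 1"
    if xy: "x \<in> \<tau> ` V" "y \<in> \<tau> ` V" and e: "er x y" for x y
  proof -
    obtain a b where ab: "x = \<tau> a" "y = \<tau> b" "a \<in> V" "b \<in> V" using xy by blast
    have "a \<noteq> b" using e ab er_irrefl by auto
    moreover have "\<not> E a b" using e ab er m by auto
    ultimately have "card V + 3 * d \<le> degree V E a + degree V E b + 3" using ore ab by blast
    then show ?thesis using deg_le[of a] deg_le[of b] ab \<tau> by (simp add: card_image)
  qed
  then have "\<not> er (\<tau> u) (\<tau> v)"
    using no_er[of "\<tau> u" "\<tau> v"] d n uv \<tau> by (simp add: card_image)
  then show ?thesis using er uv by simp
qed

lemma exists_inj: obtains \<tau> :: "'a \<Rightarrow> real" where "inj_on \<tau> V"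
proof -
  obtain g :: "'a \<Rightarrow> nat" where "inj_on g V" using finite_imp_inj_to_nat_seg[OF finV] by blast
  then have "inj_on (\<lambda>v. real (g v)) V" by (simp add: inj_on_def)
  then show ?thesis using that by blast
qed

text \<open>The conditions \<open>norm\<close> pin down the \<open>d + 1\<close> vertices
  \<open>\<nu> k\<close>. With antisymmetry and the root at its own parameter, each pinned
  polynomial has the \<open>d + 1\<close> roots in \<open>T\<close> and is zero. Antisymmetry then
  gives every other vertex the same roots.\<close>

lemma moment_placement_motion_zero:
  assumes \<tau>: "inj_on \<tau> V" and \<nu>: "inj_on \<nu> {..d}" "\<nu> ` {..d} \<subseteq> V"
    and zero: "\<And>u v. u \<in> V \<Longrightarrow> v \<in> V \<Longrightarrow> strain d (moment_placement \<tau>) m u v = 0"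
    and norm: "\<And>l k. (l, k) \<in> pair_index d \<Longrightarrow> poly (motion_poly d \<tau> m (\<nu> k)) (\<tau> (\<nu> l)) = 0"
    and v: "v \<in> V" "i < d"
  shows "m (v, i) = 0"
proof -
  let ?f = "motion_poly d \<tau> m"
  have anti: "poly (?f u) (\<tau> w) = - poly (?f w) (\<tau> u)" if "u \<in> V" "w \<in> V" for u w
    using zero[OF that] by (simp add: strain_moment_placement)
  define T where "T = (\<tau> \<circ> \<nu>) ` {..d}"
  have inj: "inj_on (\<tau> \<circ> \<nu>) {..d}" using \<tau> \<nu> by (metis comp_inj_on inj_on_subset)
  have T: "finite T" "card T = Suc d"
    using card_image[OF inj] by (simp_all only: T_def finite_imageI finite_atMost card_atMost)
  have f0: "?f u = 0" if "\<And>t. t \<in> T \<Longrightarrow> poly (?f u) t = 0" for u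
    by (rule poly_eq_0_many[OF T(1)]) (use T that degree_motion_poly[of d \<tau> m u] in auto)
  have "?f (\<nu> k) = 0" if k: "k \<le> d" for k
  proof (rule f0)
    fix t assume "t \<in> T"
    then obtain l where l: "l \<le> d" "t = \<tau> (\<nu> l)" by (auto simp: T_def)
    have V: "\<nu> k \<in> V" "\<nu> l \<in> V" using \<nu> k l by auto
    consider "l < k" | "l = k" | "k < l" by linarith
    then show "poly (?f (\<nu> k)) t = 0"
    proof cases
      case 1
      then show ?thesis using norm[of l k] k l by (simp add: pair_index_def)
    next
      case 2
      then show ?thesis by (simp add: poly_motion_poly l)
    next
      case 3
      then have "poly (?f (\<nu> l)) (\<tau> (\<nu> k)) = 0" using norm[of k l] l by (simp add: pair_index_def)
      then show ?thesis using anti[OF V] l by simp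
    qed
  qed
  then have "?f v = 0"
    using anti[OF v(1)] \<nu> by (intro f0) (auto simp: T_def image_subset_iff)
  then show ?thesis using coeff_motion_poly[OF v(2), of \<tau> m v] by simp
qed

text \<open>A largest independent set \<open>B\<close> spans all edge rows. If it were too small,
  its equations and the pinning conditions would have a nonzero common solution \<open>m\<close>.
  This \<open>m\<close> strains no edge, hence no pair, so pinning makes it zero.\<close>

lemma exists_independent_edges:
  assumes \<tau>: "inj_on \<tau> V"
  obtains B where "B \<subseteq> {(u, v). E u v}" "lin_indep B (V \<times> {..<d}) (rigidity_row (moment_placement \<tau>))"
    "card (V \<times> {..<d}) \<le> card B + card (pair_index d)"
proof -
  let ?x = "moment_placement \<tau>" and ?I = "V \<times> {..<d}"
  let ?P = "\<lambda>B. B \<subseteq> {(u, v). E u v} \<and> lin_indep B ?I (rigidity_row ?x)"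
  have EV: "{(u, v). E u v} \<subseteq> V \<times> V" using graph by (auto simp: simple_graph_def)
  have finE: "finite {(u, v). E u v}" using EV finV by (meson finite_SigmaI finite_subset)
  have "?P {}" by (simp add: lin_indep_def)
  moreover have "\<forall>B. ?P B \<longrightarrow> card B < Suc (card {(u, v). E u v})"
    using card_mono[OF finE] by (simp add: less_Suc_eq_le)
  ultimately have "\<exists>B. ?P B \<and> (\<forall>B'. ?P B' \<longrightarrow> card B' \<le> card B)"
    by (rule ex_has_greatest_nat)
  then obtain B where B: "?P B" "\<And>B'. ?P B' \<Longrightarrow> card B' \<le> card B" by (elim exE conjE) simp
  have finB: "finite B" using B(1) finE finite_subset by blast
  have "card ?I \<le> card B + card (pair_index d)"
  proof (rule ccontr)
    assume "\<not> ?thesis"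
    then have less: "card (B <+> pair_index d) < card ?I" 
      using finB by (simp add: card_Plus finite_pair_index)
    have "\<exists>\<nu>. \<nu> ` {..d} \<subseteq> V \<and> inj_on \<nu> {..d}"
      using n by (intro card_le_inj finV) simp_all
    then obtain \<nu> where \<nu>: "inj_on \<nu> {..d}" "\<nu> ` {..d} \<subseteq> V"
      by (elim exE conjE) (rule that)
    define A where "A j k = (case j of Inl e \<Rightarrow> rigidity_row ?x e k
      | Inr (l, r) \<Rightarrow> of_bool (fst k = \<nu> r) * (\<tau> (\<nu> r) ^ Suc (snd k) - \<tau> (\<nu> l) ^ Suc (snd k)))" for j k
    have "\<exists>m. (\<exists>k\<in>?I. m k \<noteq> 0) \<and> (\<forall>j\<in>B <+> pair_index d. (\<Sum>k\<in>?I. A j k * m k) = 0)"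
      using finB finV by (intro underdetermined_system less) (simp_all add: finite_pair_index)
    then obtain m where m: "\<exists>k\<in>?I. m k \<noteq> 0" "\<And>j. j \<in> B <+> pair_index d \<Longrightarrow> (\<Sum>k\<in>?I. A j k * m k) = 0"
      by (elim exE conjE) simp
    have mB: "(\<Sum>k\<in>?I. rigidity_row ?x e k * m k) = 0" if "e \<in> B" for e
      using m(2)[OF InlI[OF that]] by (simp add: A_def)
    have "strain d ?x m u v = 0" if e: "E u v" for u v
    proof -
      have uv: "u \<in> V" "v \<in> V" using e EV by auto
      have "(\<Sum>k\<in>?I. rigidity_row ?x (u, v) k * m k) = 0"
      proof (cases "(u, v) \<in> B")
        case False
        then have "\<not> ?P (insert (u, v) B)" using B(2)[of "insert (u, v) B"] finB by auto
        then have "\<not> lin_indep (insert (u, v) B) ?I (rigidity_row ?x)" using B(1) e by auto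
        then show ?thesis
          using lin_dep_insert_kernel[OF finB False, of ?I "rigidity_row ?x" m] B(1) mB by simp
      qed (rule mB)
      then show ?thesis using sum_rigidity_row[OF finV uv] by metis
    qed
    then have zero: "strain d ?x m u v = 0" if "u \<in> V" "v \<in> V" for u v
      using moment_placement_rigid[OF \<tau> _ that, of m] by blast
    have "poly (motion_poly d \<tau> m (\<nu> r)) (\<tau> (\<nu> l)) = 0" if lr: "(l, r) \<in> pair_index d" for l r
    proof -
      have r: "\<nu> r \<in> V" using lr \<nu> by (auto simp: pair_index_def)
      have "0 = (\<Sum>k\<in>?I. A (Inr (l, r)) k * m k)" using m(2)[OF InrI[OF lr]] by simp
      also have "\<dots> = (\<Sum>w\<in>V. \<Sum>i<d. A (Inr (l, r)) (w, i) * m (w, i))"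
        by (simp add: sum.cartesian_product split_def)
      also have "\<dots> = (\<Sum>w\<in>V. if w = \<nu> r then (\<Sum>i<d. (\<tau> (\<nu> r) ^ Suc i - \<tau> (\<nu> l) ^ Suc i) * m (\<nu> r, i)) else 0)"
        by (intro sum.cong refl) (simp add: A_def del: power_Suc)
      also have "\<dots> = poly (motion_poly d \<tau> m (\<nu> r)) (\<tau> (\<nu> l))"
        using r finV by (simp add: poly_motion_poly del: power_Suc)
      finally show ?thesis by simp
    qed
    then have "m (v, i) = 0" if "v \<in> V" "i < d" for v i
      using moment_placement_motion_zero[OF \<tau> \<nu> zero _ that] by blast
    with m(1) show False by auto
  qed
  with B(1) show ?thesis using that by blast
qed

text \<open>The rows are orthogonal to the trivial motions, which are independent at
  \<open>x\<close>: on the moment curve the homogeneous coordinates are powers of the parameter, and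
  their independence transfers to \<open>x\<close>.\<close>

lemma lin_indep_card_at_generic:
  assumes x: "alg_indep_Q (V \<times> {..<d}) x" and B: "B \<subseteq> V \<times> V"
    and ind: "lin_indep B (V \<times> {..<d}) (rigidity_row x)"
  shows "card B + card (pair_index d) \<le> card (V \<times> {..<d})"
proof -
  obtain \<tau> :: "'a \<Rightarrow> real" where \<tau>: "inj_on \<tau> V" by (rule exists_inj)
  have "lin_indep {..d} V (\<lambda>s w. hom_coord (moment_placement \<tau>) w s)"
    unfolding lin_indep_def
  proof (intro allI impI ballI)
    fix c s
    assume c: "\<forall>w\<in>V. (\<Sum>s\<le>d. c s * hom_coord (moment_placement \<tau>) w s) = 0" and s: "s \<in> {..d}"
    define p where "p = (\<Sum>s\<le>d. monom (c s) s)"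
    have "p = 0"
    proof (rule poly_eq_0_many)
      show "finite (\<tau> ` V)" using finV by simp
      have "deg p \<le> d" unfolding p_def by (intro degree_sum_le) (auto intro: order_trans[OF degree_monom_le])
      then show "deg p < card (\<tau> ` V)" using n \<tau> by (simp add: card_image)
      fix t assume "t \<in> \<tau> ` V"
      then obtain w where w: "w \<in> V" "t = \<tau> w" by blast
      have "hom_coord (moment_placement \<tau>) w s = \<tau> w ^ s" for s
        by (cases s) (simp_all add: hom_coord_def moment_placement_def)
      then have "(\<Sum>s\<le>d. c s * \<tau> w ^ s) = 0" using bspec[OF c w(1)] by simp
      then show "poly p t = 0" using w by (simp add: p_def poly_sum poly_monom)
    qed
    moreover have "coeff p s = c s" using s by (simp add: p_def coeff_sum)
    ultimately show "c s = 0" by simp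
  qed
  then have "lin_indep {..d} V (\<lambda>s w. hom_coord x w s)"
  proof (rule lin_indep_transfer[OF x, rotated 4])
    fix s w assume "s \<in> {..d}" "w \<in> V"
    then show "polyfun (V \<times> {..<d}) (\<lambda>x. hom_coord x w s)"
      by (cases s) (auto simp: hom_coord_def intro: polyfun_1 polyfun_var)
  qed (use finV in auto)
  then have triv: "lin_indep (pair_index d) (V \<times> {..<d}) (trivial_motion x)"
    by (rule lin_indep_trivial_motion)
  show ?thesis
  proof (rule lin_indep_orthogonal_card[OF _ finite_pair_index _ ind triv])
    fix s t assume "s \<in> B" "t \<in> pair_index d"
    then show "(\<Sum>k\<in>V \<times> {..<d}. rigidity_row x s k * trivial_motion x t k) = 0"
      using B sum_rigidity_row[OF finV, of "fst s" "snd s" x "trivial_motion x t" d]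
      by (auto simp: strain_trivial_motion)
  qed (use B finV in \<open>auto intro: finite_subset[of B "V \<times> V"]\<close>)
qed

section \<open>Continuous motions of a generic placement\<close>

lemma ore_d_rigid: "d_rigid V E d"
  unfolding d_rigid_def rigid_framework_def
proof (intro allI impI notI, elim exE conjE)
  fix p :: "'a \<Rightarrow> nat \<Rightarrow> real" and q :: "real \<Rightarrow> 'a \<Rightarrow> nat \<Rightarrow> real"
  assume gen: "generic V d p"
    and q: "\<forall>v\<in>V. \<forall>i<d. continuous_on {0..1} (\<lambda>t. q t v i)"
      "\<forall>v\<in>V. \<forall>i<d. q 0 v i = p v i"
      "\<forall>t\<in>{0..1}. \<forall>u\<in>V. \<forall>v\<in>V. E u v \<longrightarrow> sqdist d (q t) u v = sqdist d p u v"
    and changed: "\<exists>t\<in>{0..1}. \<exists>u\<in>V. \<exists>v\<in>V. sqdist d (q t) u v \<noteq> sqdist d p u v"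
  define I where "I = V \<times> {..<d}"
  define x where "x = (\<lambda>(v, i). p v i)"
  have x: "alg_indep_Q (V \<times> {..<d}) x" using gen by (simp add: generic_def x_def)
  obtain \<tau> :: "'a \<Rightarrow> real" where \<tau>: "inj_on \<tau> V" by (rule exists_inj)
  obtain B where B: "B \<subseteq> {(u, v). E u v}" "lin_indep B I (rigidity_row (moment_placement \<tau>))"
    "card I \<le> card B + card (pair_index d)"
    using exists_independent_edges[OF \<tau>] unfolding I_def by metis
  have EV: "E u v \<Longrightarrow> u \<in> V \<and> v \<in> V" for u v using graph by (simp add: simple_graph_def)
  have BV: "B \<subseteq> V \<times> V" using B(1) EV by blast
  have finB: "finite B" using BV finV by (meson finite_SigmaI finite_subset)
  let ?G = "\<lambda>B x. gram_det B (rigidity_gram V d x)"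
  have gen_nz: "?G C x \<noteq> 0" if "C \<subseteq> V \<times> V" "?G C y \<noteq> 0" for C y
    using polyfun_zero_at_alg_indep[OF x _ polyfun_rigidity_gram_det[OF finV that(1)], where y = y] that finV by auto
  have Gx: "?G B x \<noteq> 0"
    using gen_nz[OF BV] rigidity_gram_det_nonzero_iff[OF finV BV] B(2) unfolding I_def by blast
  \<comment> \<open>Independence at any \<open>y\<close> would pass to \<open>x\<close> and exceed
    the maximal rank there. So the dependence holds at every placement, in particular at
    midpoints.\<close>
  have dep: "\<not> lin_indep (insert e B) I (rigidity_row y)" if e: "e \<in> V \<times> V" "e \<notin> B" for e y
  proof
    assume "lin_indep (insert e B) I (rigidity_row y)"
    moreover have eB: "insert e B \<subseteq> V \<times> V" using e BV by simp
    ultimately have "lin_indep (insert e B) (V \<times> {..<d}) (rigidity_row x)"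
      using gen_nz[OF eB] rigidity_gram_det_nonzero_iff[OF finV eB] unfolding I_def by blast
    from lin_indep_card_at_generic[OF x eB this] B(3) e finB show False by (simp add: I_def)
  qed
  have sq: "sqdist d r u v = sqd d (\<lambda>(v, i). r v i) u v" for r :: "'a \<Rightarrow> nat \<Rightarrow> real" and u v
    by (simp add: sqdist_def sqd_def)
  define y where "y t = (\<lambda>(v, i). q t v i)" for t
  define cong where "cong t \<longleftrightarrow> (\<forall>u\<in>V. \<forall>v\<in>V. sqd d (y t) u v = sqd d x u v)" for t
  have tends: "((\<lambda>t. y t (v, i)) \<longlongrightarrow> y a (v, i)) (at a within {0..1})"
    if "a \<in> {0..1}" "v \<in> V" "i < d" for a v i
    using q(1) that by (simp add: y_def continuous_on_def)
  have edge: "sqd d (y t) u v = sqd d x u v" if "t \<in> {0..1}" "E u v" for t u v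
    using q(3) that(1) that(2) EV[OF that(2)] by (simp add: sq x_def y_def)
  \<comment> \<open>Congruence to the initial placement is a locally constant property on the
    interval.\<close>
  have "cong 0 = cong t" if t: "t \<in> {0..1}" for t
  proof (rule connected_local_const[of "{0..1::real}" 0 t])
    show "\<forall>a\<in>{0..1}. \<forall>\<^sub>F b in at a within {0..1}. cong a = cong b"
    proof
      fix a :: real assume a: "a \<in> {0..1}"
      show "\<forall>\<^sub>F b in at a within {0..1}. cong a = cong b"
      proof (cases "cong a")
        case False
        then obtain u v where uv: "u \<in> V" "v \<in> V" "sqd d (y a) u v \<noteq> sqd d x u v" by (auto simp: cong_def)
        have "((\<lambda>t. sqd d (y t) u v) \<longlongrightarrow> sqd d (y a) u v) (at a within {0..1})"
          unfolding sqd_def using tends[OF a] uv by (intro tendsto_sum tendsto_power tendsto_diff) auto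
        then have "\<forall>\<^sub>F b in at a within {0..1}. sqd d (y b) u v \<noteq> sqd d x u v"
          using uv(3) by (rule tendsto_imp_eventually_ne)
        then show ?thesis
          by (rule eventually_mono) (use uv False in \<open>auto simp: cong_def\<close>)
      next
        case True
        define r where "r t k = (y a k + y t k) / 2" for t k
        have tr: "((\<lambda>t. r t (v, i)) \<longlongrightarrow> y a (v, i)) (at a within {0..1})" if "v \<in> V" "i < d" for v i
        proof -
          have "((\<lambda>t. (y a (v, i) + y t (v, i)) / 2) \<longlongrightarrow> (y a (v, i) + y a (v, i)) / 2) (at a within {0..1})"
            using tends[OF a that] by (intro tendsto_divide tendsto_add tendsto_const) auto
          then show ?thesis by (simp add: r_def)
        qed
        \<comment> \<open>By continuity the rows of \<open>B\<close> stay independent at the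
          midpoints \<open>r b\<close> for \<open>b\<close> near \<open>a\<close>.\<close>
        have "((\<lambda>t. ?G B (r t)) \<longlongrightarrow> ?G B (y a)) (at a within {0..1})"
          unfolding rigidity_gram_def rigidity_row_def using BV tr
          by (intro tendsto_gram_det finB tendsto_sum tendsto_mult tendsto_diff tendsto_const) auto
        moreover have "?G B (y a) \<noteq> 0"
          using gram_det_congruent[OF finV BV, of d "y a" x] True Gx by (simp add: cong_def)
        ultimately have "\<forall>\<^sub>F b in at a within {0..1}. ?G B (r b) \<noteq> 0"
          by (rule tendsto_imp_eventually_ne)
        moreover have "\<forall>\<^sub>F b in at a within {0..1}. b \<in> {0..1}"
          by (auto simp: eventually_at_filter)
        ultimately show ?thesis
        proof eventually_elim
          case (elim b)
          have ind: "lin_indep B I (rigidity_row (r b))"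
            using elim(1) rigidity_gram_det_nonzero_iff[OF finV BV] unfolding I_def by blast
          \<comment> \<open>\<open>r b\<close> is the midpoint: \<open>|B|\<^sup>2 - |A|\<^sup>2 = 2 ((A + B) / 2) \<bullet> (B - A)\<close>\<close>
          define m where "m k = y b k - y a k" for k
          have mid: "2 * strain d (r b) m u v = sqd d (y b) u v - sqd d (y a) u v" for u v
            unfolding strain_def sqd_def sum_subtractf[symmetric] sum_distrib_left
            by (intro sum.cong refl) (simp add: r_def m_def power2_eq_square field_simps)
          have ker: "(\<Sum>k\<in>I. rigidity_row (r b) e k * m k) = 0" if e: "e \<in> B" for e
          proof -
            obtain u v where uv: "e = (u, v)" "E u v" using e B(1) by auto
            have "sqd d (y b) u v = sqd d (y a) u v" using edge[OF _ uv(2)] elim(2) a by simp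
            then show ?thesis
              using sum_rigidity_row[OF finV, of u v "r b" m d] EV[OF uv(2)] mid[of u v]
              by (simp add: I_def uv)
          qed
          \<comment> \<open>At \<open>r b\<close> the rows of \<open>B\<close> span those of all
            pairs by \<open>dep\<close>, so \<open>m\<close> strains no pair.\<close>
          have "sqd d (y b) u v = sqd d (y a) u v" if uv: "u \<in> V" "v \<in> V" for u v
          proof -
            have "(\<Sum>k\<in>I. rigidity_row (r b) (u, v) k * m k) = 0"
            proof (cases "(u, v) \<in> B")
              case False
              then show ?thesis using lin_dep_insert_kernel[OF finB False ind dep, of m] ker uv by simp
            qed (rule ker)
            then show ?thesis
              using sum_rigidity_row[OF finV uv, of "r b" m d] mid[of u v] by (simp add: I_def)
          qed
          then show "cong a = cong b" by (simp add: cong_def)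
        qed
      qed
    qed
  qed (use t in auto)
  moreover have "cong 0" unfolding cong_def sqd_def by (auto simp: y_def x_def q(2))
  ultimately show False using changed by (auto simp: cong_def sq x_def y_def)
qed

end

theorem theorem1p3:
  fixes V :: "'a set" and E :: "'a \<Rightarrow> 'a \<Rightarrow> bool" and n d :: nat
  assumes "simple_graph V E"
    and "card V = n" and "n \<ge> 1" and "d \<ge> 1"
    and "\<forall>u\<in>V. \<forall>v\<in>V. u \<noteq> v \<and> \<not> E u v \<longrightarrow>
           degree V E u + degree V E v \<ge> n + 3 * d - 3"
  shows "d_rigid V E d"
proof (cases "\<forall>u\<in>V. \<forall>v\<in>V. u \<noteq> v \<longrightarrow> E u v")
  case True
  have "sqdist d q u v = sqdist d p u v"
    if "\<forall>u\<in>V. \<forall>v\<in>V. E u v \<longrightarrow> sqdist d q u v = sqdist d p u v" "u \<in> V" "v \<in> V"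
    for p q :: "'a \<Rightarrow> nat \<Rightarrow> real" and u v
    using that True by (cases "u = v") (auto simp: sqdist_def)
  then show ?thesis unfolding d_rigid_def rigid_framework_def by blast
next
  case False
  then obtain u v where uv: "u \<in> V" "v \<in> V" "u \<noteq> v" "\<not> E u v" by blast
  have fin: "finite V" using assms(1) by (simp add: simple_graph_def)
  have deg2: "degree V E a + 2 \<le> n" if ab: "a \<in> V" "b \<in> V" "a \<noteq> b" "\<not> E a b" for a b
  proof -
    have "card {w \<in> V. E a w} + card {a, b} = card ({w \<in> V. E a w} \<union> {a, b})"
      using fin ab assms(1) by (intro card_Un_disjoint[symmetric]) (auto simp: simple_graph_def)
    also have "\<dots> \<le> card V" using fin ab by (intro card_mono) auto
    finally show ?thesis using ab assms(2) by (simp add: degree_def)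
  qed
  have "\<not> E v u" using uv assms(1) by (auto simp: simple_graph_def)
  \<comment> \<open>Non-adjacent vertices have degree at most \<open>n - 2\<close> each, so Ore's
    condition gives \<open>3 * d + 1 <= n\<close>.\<close>
  then have "n + 3 * d - 3 + 4 \<le> 2 * n"
    using assms(5) uv deg2[of u v] deg2[of v u] by fastforce
  then have "3 * d < card V" using assms(2,4) by simp
  then interpret ore_graph V E d
    using assms by unfold_locales (auto, fastforce)
  show ?thesis by (rule ore_d_rigid)
qed

end
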